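(* Let $\mathcal H$ be a Hilbert space of finite dimension $d$ and $\mathcal K$ a finite-dimensional Hilbert space. Let $\{M_j\}_{j=1}^d$ be positive operators on $\mathcal H$ with $M_j>0$ and $\sum_{j=1}^dM_j=I_{\mathcal H}$, let $\{|e_j\rangle\}_{j=1}^d$ be an orthonormal basis of $\mathcal H$, and let $\Phi$ be the quantum-classical channel $\Phi(\sigma)=\sum_{j=1}^d\mathrm{Tr}(M_j\sigma)|e_j\rangle\langle e_j|$. Then for every quantum channel $\Omega:\mathfrak S(\mathcal K)\to\mathfrak S(\mathcal K)$ and every $\rho\in\mathfrak S(\mathcal H\otimes\mathcal K)$, $$H_{\Phi\otimes\Omega}(\rho)\ge H_\Phi(\mathrm{Tr}_{\mathcal K}(\rho))+H_\Omega(\mathrm{Tr}_{\mathcal H}(\rho)).$$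
   Context: $\mathfrak S(\cdot)$ denotes the set of density operators; a quantum channel is a completely positive trace-preserving linear map; $S(\sigma)=-\mathrm{Tr}(\sigma\log\sigma)$ is the von Neumann entropy. For a channel $\Psi$ with input space $\mathcal L$ and $\sigma\in\mathfrak S(\mathcal L)$, $H_\Psi(\sigma):=\min\sum_{j}\pi_jS(\Psi(\sigma_j))$, the minimum over all finite decompositions $\sigma=\sum_j\pi_j\sigma_j$ with $\{\pi_j\}$ a probability distribution and $\sigma_j\in\mathfrak S(\mathcal L)$. *)

theory Defs
  imports "Jordan_Normal_Form.Matrix" "Jordan_Normal_Form.Char_Poly"
    "HOL-Computational_Algebra.Polynomial"
begin

text \<open>Operators on C^n are represented as complex n x n matrices. The composite
 space C^n1 (x) C^n2 is C^(n1*n2) with the basis index (i,k) encoded as i*n2+k.\<close>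

definition adj :: "complex mat \<Rightarrow> complex mat" where
  "adj A = mat (dim_col A) (dim_row A) (\<lambda>(i,j). cnj (A $$ (j,i)))"

definition qform :: "complex mat \<Rightarrow> complex vec \<Rightarrow> complex" where
  "qform A v = (\<Sum>i<dim_vec v. cnj (v $ i) * (A *\<^sub>v v) $ i)"

definition psd :: "nat \<Rightarrow> complex mat \<Rightarrow> bool" where
  "psd n A \<longleftrightarrow> A \<in> carrier_mat n n \<and> adj A = A \<and>
     (\<forall>v \<in> carrier_vec n. 0 \<le> Re (qform A v))"

definition pd :: "nat \<Rightarrow> complex mat \<Rightarrow> bool" where
  "pd n A \<longleftrightarrow> A \<in> carrier_mat n n \<and> adj A = A \<and>
     (\<forall>v \<in> carrier_vec n. v \<noteq> 0\<^sub>v n \<longrightarrow> 0 < Re (qform A v))"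

definition mtrace :: "complex mat \<Rightarrow> complex" where
  "mtrace A = (\<Sum>i<dim_row A. A $$ (i,i))"

definition density :: "nat \<Rightarrow> complex mat \<Rightarrow> bool" where
  "density n A \<longleftrightarrow> psd n A \<and> mtrace A = 1"

text \<open>Von Neumann entropy -Tr(A log A), computed through the eigenvalues of A
 (roots of the characteristic polynomial, counted with algebraic multiplicity);
 0 log 0 = 0.\<close>
definition vn_entropy :: "complex mat \<Rightarrow> real" where
  "vn_entropy A = - (\<Sum>x\<in>{x. poly (char_poly A) x = 0}.
      of_nat (order x (char_poly A)) * (if Re x = 0 then 0 else Re x * ln (Re x)))"

definition unit_mat :: "nat \<Rightarrow> nat \<Rightarrow> nat \<Rightarrow> complex mat" where
  "unit_mat n i j = mat n n (\<lambda>(p,q). if p = i \<and> q = j then 1 else 0)"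

text \<open>Tensor product of two maps (the first acting on n1 x n1, the second on
 n2 x n2 matrices, both dimension preserving), defined by linear extension on
 the product basis E_ij (x) F_kl.\<close>
definition tensor_map :: "nat \<Rightarrow> nat \<Rightarrow> (complex mat \<Rightarrow> complex mat) \<Rightarrow>
    (complex mat \<Rightarrow> complex mat) \<Rightarrow> complex mat \<Rightarrow> complex mat" where
  "tensor_map n1 n2 F G X = mat (n1*n2) (n1*n2) (\<lambda>(p,q).
     \<Sum>i<n1. \<Sum>j<n1. \<Sum>k<n2. \<Sum>l<n2.
       X $$ (i*n2+k, j*n2+l) * (F (unit_mat n1 i j)) $$ (p div n2, q div n2)
         * (G (unit_mat n2 k l)) $$ (p mod n2, q mod n2))"

definition linear_map :: "nat \<Rightarrow> (complex mat \<Rightarrow> complex mat) \<Rightarrow> bool" where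
  "linear_map n F \<longleftrightarrow>
     (\<forall>A \<in> carrier_mat n n. F A \<in> carrier_mat n n) \<and>
     (\<forall>A \<in> carrier_mat n n. \<forall>B \<in> carrier_mat n n. F (A + B) = F A + F B) \<and>
     (\<forall>A \<in> carrier_mat n n. \<forall>c. F (c \<cdot>\<^sub>m A) = c \<cdot>\<^sub>m F A)"

definition completely_positive :: "nat \<Rightarrow> (complex mat \<Rightarrow> complex mat) \<Rightarrow> bool" where
  "completely_positive n F \<longleftrightarrow>
     (\<forall>k X. psd (k*n) X \<longrightarrow> psd (k*n) (tensor_map k n (\<lambda>A. A) F X))"

definition trace_preserving :: "nat \<Rightarrow> (complex mat \<Rightarrow> complex mat) \<Rightarrow> bool" where
  "trace_preserving n F \<longleftrightarrow> (\<forall>A \<in> carrier_mat n n. mtrace (F A) = mtrace A)"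

definition channel :: "nat \<Rightarrow> (complex mat \<Rightarrow> complex mat) \<Rightarrow> bool" where
  "channel n F \<longleftrightarrow> linear_map n F \<and> completely_positive n F \<and> trace_preserving n F"

text \<open>H_Psi(sigma): minimum (infimum; it is attained) of the average output
 entropy over finite convex decompositions of sigma into states.\<close>
definition H_map :: "nat \<Rightarrow> (complex mat \<Rightarrow> complex mat) \<Rightarrow> complex mat \<Rightarrow> real" where
  "H_map n F \<sigma> = Inf {(\<Sum>j<N. p j * vn_entropy (F (s j))) | (N::nat) p s.
      (\<forall>j<N. 0 \<le> p j \<and> density n (s j)) \<and> (\<Sum>j<N. p j) = 1 \<and>
      (\<forall>a<n. \<forall>b<n. \<sigma> $$ (a,b) = (\<Sum>j<N. complex_of_real (p j) * s j $$ (a,b)))}"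

definition ptrace2 :: "nat \<Rightarrow> nat \<Rightarrow> complex mat \<Rightarrow> complex mat" where
  "ptrace2 n1 n2 X = mat n1 n1 (\<lambda>(i,j). \<Sum>k<n2. X $$ (i*n2+k, j*n2+k))"

definition ptrace1 :: "nat \<Rightarrow> nat \<Rightarrow> complex mat \<Rightarrow> complex mat" where
  "ptrace1 n1 n2 X = mat n2 n2 (\<lambda>(k,l). \<Sum>i<n1. X $$ (i*n2+k, i*n2+l))"

definition qc_channel :: "nat \<Rightarrow> (nat \<Rightarrow> complex mat) \<Rightarrow> (nat \<Rightarrow> complex vec) \<Rightarrow>
    complex mat \<Rightarrow> complex mat" where
  "qc_channel d M e \<sigma> = mat d d (\<lambda>(a,b).
     \<Sum>j<d. mtrace (M j * \<sigma>) * (e j $ a * cnj (e j $ b)))"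

definition cinner :: "complex vec \<Rightarrow> complex vec \<Rightarrow> complex" where
  "cinner u v = (\<Sum>i<dim_vec v. cnj (u $ i) * v $ i)"

end

theory Submission
  imports Defs "Jordan_Normal_Form.Schur_Decomposition"
begin

text \<open>For a single state \<open>\<sigma>\<close> on \<open>H \<otimes> K\<close> the output of \<open>\<Phi> \<otimes> \<Omega>\<close> is unitarily equivalent to
  the block diagonal operator with blocks \<open>\<Omega>(T\<^sub>a)\<close>, where \<open>T\<^sub>a = Tr\<^sub>H ((M\<^sub>a \<otimes> I) \<sigma>) = q\<^sub>a s\<^sub>a\<close>
  with \<open>q\<^sub>a = Tr T\<^sub>a\<close> and \<open>s\<^sub>a\<close> a state. Its entropy is therefore the Shannon entropy of \<open>q\<close> plus
  \<open>\<Sum>\<^sub>a q\<^sub>a S(\<Omega>(s\<^sub>a))\<close>. The first summand equals \<open>S(\<Phi>(Tr\<^sub>K \<sigma>))\<close>, and the second is at least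
  \<open>H\<^sub>\<Omega>(Tr\<^sub>H \<sigma>)\<close>, because \<open>\<Sum>\<^sub>a M\<^sub>a = I\<close> gives \<open>\<Sum>\<^sub>a q\<^sub>a s\<^sub>a = Tr\<^sub>H \<sigma>\<close>. Averaging over a
  decomposition of \<open>\<rho>\<close> yields the theorem, since \<open>H\<^sub>\<Omega>\<close> is a convex roof and hence convex.\<close>

section \<open>Positive semidefinite matrices\<close>

definition sesq :: "complex mat \<Rightarrow> complex vec \<Rightarrow> complex vec \<Rightarrow> complex" where
  "sesq A u v = (\<Sum>i<dim_row A. \<Sum>j<dim_col A. cnj (u $ i) * A $$ (i,j) * v $ j)"

lemma qform_eq_sesq:
  assumes "A \<in> carrier_mat n n" "v \<in> carrier_vec n"
  shows "qform A v = sesq A v v"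
  using assms
  by (simp add: qform_def sesq_def scalar_prod_def lessThan_atLeast0 sum_distrib_left mult_ac)

lemma sesq_unit_vec:
  assumes "A \<in> carrier_mat n n" "i < n" "j < n"
  shows "sesq A (unit_vec n i) (unit_vec n j) = A $$ (i,j)"
proof -
  have "sesq A (unit_vec n i) (unit_vec n j)
      = (\<Sum>k<n. \<Sum>l<n. if l = j then if k = i then A $$ (i,j) else 0 else 0)"
    unfolding sesq_def using assms by (intro sum.cong) auto
  then show ?thesis using assms by simp
qed

lemma qform_unit_vec:
  assumes "A \<in> carrier_mat n n" "i < n"
  shows "qform A (unit_vec n i) = A $$ (i,i)"
  using assms by (simp add: qform_eq_sesq sesq_unit_vec)

lemma qform_add_smult:
  assumes A: "A \<in> carrier_mat n n" and u: "u \<in> carrier_vec n" and v: "v \<in> carrier_vec n"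
  shows "qform A (u + t \<cdot>\<^sub>v v)
    = qform A u + t * sesq A u v + cnj t * sesq A v u + of_real ((cmod t)\<^sup>2) * qform A v"
proof -
  have "qform A (u + t \<cdot>\<^sub>v v) = sesq A (u + t \<cdot>\<^sub>v v) (u + t \<cdot>\<^sub>v v)"
    using assms by (intro qform_eq_sesq) auto
  also have "\<dots> = sesq A u u + t * sesq A u v + cnj t * sesq A v u + (t * cnj t) * sesq A v v"
    using assms by (simp add: sesq_def sum.distrib sum_distrib_left algebra_simps)
  finally show ?thesis
    by (simp only: qform_eq_sesq[OF A u] qform_eq_sesq[OF A v] complex_norm_square)
qed

lemma adj_eq_self_iff:
  assumes "A \<in> carrier_mat n n"
  shows "adj A = A \<longleftrightarrow> (\<forall>i<n. \<forall>j<n. cnj (A $$ (j,i)) = A $$ (i,j))"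
  using assms by (auto simp: adj_def mat_eq_iff)

lemma cnj_sesq:
  assumes A: "A \<in> carrier_mat n n" "adj A = A"
  shows "cnj (sesq A u v) = sesq A v u"
proof -
  have "cnj (sesq A u v) = (\<Sum>i<n. \<Sum>j<n. cnj (v $ j) * A $$ (j,i) * u $ i)"
    using A adj_eq_self_iff[OF A(1)] by (simp add: sesq_def mult_ac)
  also have "\<dots> = sesq A v u"
    using A(1) by (subst sum.swap) (simp add: sesq_def)
  finally show ?thesis .
qed

text \<open>In the order on the complex numbers \<open>0 \<le> z\<close> includes that \<open>z\<close> is real, and by polarization a
  real quadratic form has a Hermitian matrix.\<close>
lemma psd_iff_qform_nonneg:
  "psd n A \<longleftrightarrow> A \<in> carrier_mat n n \<and> (\<forall>v\<in>carrier_vec n. 0 \<le> qform A v)"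
proof
  assume A: "psd n A"
  then have carrier: "A \<in> carrier_mat n n" and herm: "adj A = A" by (auto simp: psd_def)
  have "Im (qform A v) = 0" if v: "v \<in> carrier_vec n" for v
    using cnj_sesq[OF carrier herm, of v v]
    by (simp add: qform_eq_sesq[OF carrier v] complex_eq_iff)
  then show "A \<in> carrier_mat n n \<and> (\<forall>v\<in>carrier_vec n. 0 \<le> qform A v)"
    using A by (auto simp: psd_def less_eq_complex_def)
next
  assume "A \<in> carrier_mat n n \<and> (\<forall>v\<in>carrier_vec n. 0 \<le> qform A v)"
  then have A: "A \<in> carrier_mat n n" and nonneg: "\<And>v. v \<in> carrier_vec n \<Longrightarrow> 0 \<le> qform A v"
    by auto
  have "cnj (A $$ (j,i)) = A $$ (i,j)" if ij: "i < n" "j < n" for i j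
  proof -
    have "Im (t * A $$ (i,j) + cnj t * A $$ (j,i)) = 0" for t
      using nonneg[of "unit_vec n i + t \<cdot>\<^sub>v unit_vec n j"] nonneg[of "unit_vec n i"]
        nonneg[of "unit_vec n j"] ij
      by (simp add: qform_add_smult[OF A] qform_unit_vec[OF A] sesq_unit_vec[OF A]
          less_eq_complex_def)
    from this[of 1] this[of \<i>] show ?thesis by (simp add: complex_eq_iff)
  qed
  then show "psd n A"
    using A nonneg adj_eq_self_iff[OF A] by (auto simp: psd_def less_eq_complex_def)
qed

lemma psd_carrier: "psd n A \<Longrightarrow> A \<in> carrier_mat n n"
  by (simp add: psd_def)

lemma qform_nonneg: "psd n A \<Longrightarrow> v \<in> carrier_vec n \<Longrightarrow> 0 \<le> qform A v"
  by (simp add: psd_iff_qform_nonneg)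

lemma pd_imp_psd:
  assumes "pd n A"
  shows "psd n A"
proof -
  have "0 \<le> Re (qform A v)" if "v \<in> carrier_vec n" for v
  proof (cases "v = 0\<^sub>v n")
    case True
    then show ?thesis by (simp add: qform_def)
  next
    case False
    then show ?thesis using assms that by (auto simp: pd_def less_imp_le)
  qed
  then show ?thesis using assms by (simp add: pd_def psd_def)
qed

lemma psd_diag_nonneg:
  assumes A: "psd n A" and "i < n"
  shows "0 \<le> A $$ (i,i)"
  using qform_nonneg[OF A, of "unit_vec n i"] assms psd_carrier[OF A]
  by (simp add: qform_unit_vec)

lemma mtrace_nonneg:
  assumes "psd n A"
  shows "0 \<le> mtrace A"
  using psd_diag_nonneg[OF assms] psd_carrier[OF assms]
  by (auto simp: mtrace_def intro!: sum_nonneg)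

lemma psd_Cauchy_Schwarz:
  assumes psd: "psd n A" and u: "u \<in> carrier_vec n" and v: "v \<in> carrier_vec n"
  shows "(cmod (sesq A u v))\<^sup>2 \<le> Re (qform A u) * Re (qform A v)"
proof -
  let ?z = "sesq A v u" and ?a = "Re (qform A u)" and ?b = "Re (qform A v)"
  have A: "A \<in> carrier_mat n n" and herm: "adj A = A" using psd by (auto simp: psd_def)
  have swap: "sesq A u v = cnj ?z" using cnj_sesq[OF A herm] by simp
  have nonneg: "0 \<le> ?a" "0 \<le> ?b"
    using qform_nonneg[OF psd] u v by (auto simp: less_eq_complex_def)
  have quadratic: "0 \<le> ?a - 2 * s * (cmod ?z)\<^sup>2 + s\<^sup>2 * (cmod ?z)\<^sup>2 * ?b" for s :: real
  proof -
    have cross: "Re (?z * cnj ?z) = (cmod ?z)\<^sup>2"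
      by (simp flip: complex_norm_square)
    have "0 \<le> Re (qform A (u + (- of_real s * ?z) \<cdot>\<^sub>v v))"
      using qform_nonneg[OF psd, of "u + (- of_real s * ?z) \<cdot>\<^sub>v v"] u v
      by (simp add: less_eq_complex_def)
    also have "\<dots> = ?a - 2 * s * Re (?z * cnj ?z) + s\<^sup>2 * (cmod ?z)\<^sup>2 * ?b"
      unfolding qform_add_smult[OF A u v] swap
      by (simp add: norm_mult power_mult_distrib algebra_simps)
    finally show ?thesis by (simp only: cross)
  qed
  have "(cmod ?z)\<^sup>2 \<le> ?a * ?b"
  proof (cases "?b = 0")
    case True
    have "?z = 0"
    proof (rule ccontr)
      assume "?z \<noteq> 0"
      then show False
        using quadratic[of "(?a + 1) / (cmod ?z)\<^sup>2"] nonneg True by simp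
    qed
    then show ?thesis using True by simp
  next
    case False
    then have "0 < ?b" using nonneg by simp
    then show ?thesis using quadratic[of "1 / ?b"] by (simp add: field_simps power2_eq_square)
  qed
  then show ?thesis by (simp add: swap)
qed

lemma psd_zero_diag:
  assumes A: "psd n A" and ij: "i < n" "j < n" and zero: "A $$ (i,i) = 0 \<or> A $$ (j,j) = 0"
  shows "A $$ (i,j) = 0"
  using psd_Cauchy_Schwarz[OF A, of "unit_vec n i" "unit_vec n j"] psd_carrier[OF A] ij zero
  by (auto simp: qform_unit_vec sesq_unit_vec)

lemma psd_mtrace_eq_0:
  assumes A: "psd n A" and zero: "mtrace A = 0"
  shows "A = 0\<^sub>m n n"
proof -
  have "(\<Sum>i<n. A $$ (i,i)) = 0"
    using zero psd_carrier[OF A] by (simp add: mtrace_def)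
  then have "A $$ (i,i) = 0" if "i < n" for i
    using that psd_diag_nonneg[OF A] by (subst (asm) sum_nonneg_eq_0_iff) auto
  then have "A $$ (i,j) = 0" if "i < n" "j < n" for i j
    using psd_zero_diag[OF A that] that by blast
  then show ?thesis
    using psd_carrier[OF A] by (intro eq_matI) auto
qed

text \<open>If \<open>A $$ (k,k) = 0\<close>, the convention \<open>x / 0 = 0\<close> makes the Schur complement \<open>A\<close> itself.\<close>
definition schur_complement :: "complex mat \<Rightarrow> nat \<Rightarrow> complex mat" where
  "schur_complement A k = mat (dim_row A) (dim_col A)
     (\<lambda>(i,j). A $$ (i,j) - A $$ (i,k) * A $$ (k,j) / A $$ (k,k))"

lemma psd_schur_complement:
  assumes psd: "psd n A" and k: "k < n"
  shows "psd n (schur_complement A k)"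
  unfolding psd_iff_qform_nonneg
proof (intro conjI ballI)
  have A: "A \<in> carrier_mat n n" and herm: "adj A = A" using psd by (auto simp: psd_def)
  then show carrier: "schur_complement A k \<in> carrier_mat n n" by (simp add: schur_complement_def)
  fix v :: "complex vec" assume v: "v \<in> carrier_vec n"
  let ?c = "A $$ (k,k)" and ?z = "sesq A (unit_vec n k) v"
  have unit_row: "?z = (\<Sum>j<n. A $$ (k,j) * v $ j)"
    unfolding sesq_def using A k
    by (subst sum.swap) (simp add: if_distrib[of cnj] if_distrib[of "\<lambda>x. x * _"] cong: if_cong)
  have unit_col: "cnj ?z = (\<Sum>i<n. cnj (v $ i) * A $$ (i,k))"
    unfolding unit_row using adj_eq_self_iff[OF A] herm k by (simp add: mult.commute)
  have "qform (schur_complement A k) v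
      = qform A v - (\<Sum>i<n. \<Sum>j<n. (cnj (v $ i) * A $$ (i,k)) * (A $$ (k,j) * v $ j)) / ?c"
    using A unfolding qform_eq_sesq[OF carrier v] qform_eq_sesq[OF A v]
    by (simp add: sesq_def schur_complement_def sum_subtractf sum_divide_distrib algebra_simps)
  also have "(\<Sum>i<n. \<Sum>j<n. (cnj (v $ i) * A $$ (i,k)) * (A $$ (k,j) * v $ j)) = cnj ?z * ?z"
    unfolding unit_col unfolding unit_row by (simp add: sum_product)
  finally have qform_eq: "qform (schur_complement A k) v = qform A v - of_real ((cmod ?z)\<^sup>2) / ?c"
    by (simp only: complex_norm_square mult.commute)
  obtain c q where real_values: "?c = of_real c" "0 \<le> c" "qform A v = of_real q" "0 \<le> q"
    using psd_diag_nonneg[OF psd k] qform_nonneg[OF psd v]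
    by (auto simp: less_eq_complex_def complex_eq_iff)
  have "(cmod ?z)\<^sup>2 \<le> c * q"
    using psd_Cauchy_Schwarz[OF psd, of "unit_vec n k" v] v real_values k
    by (simp add: qform_unit_vec[OF A])
  then have "(cmod ?z)\<^sup>2 / c \<le> q"
    using real_values by (cases "c = 0") (auto simp: field_simps)
  then show "0 \<le> qform (schur_complement A k) v"
    unfolding qform_eq real_values by (simp add: less_eq_complex_def)
qed

lemma schur_complement_index_eq_0:
  assumes A: "psd n A" and ij: "i < n" "j < n" and k: "i = k \<or> j = k"
  shows "schur_complement A k $$ (i,j) = 0"
proof (cases "A $$ (k,k) = 0")
  case True
  then have "A $$ (i,j) = 0" using psd_zero_diag[OF A ij] k by blast
  then show ?thesis using True ij psd_carrier[OF A] by (simp add: schur_complement_def)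
next
  case False
  then show ?thesis using k ij psd_carrier[OF A] by (auto simp: schur_complement_def)
qed

lemma index_mult_mat_sum:
  assumes "A \<in> carrier_mat n k" "B \<in> carrier_mat k m" "i < n" "j < m"
  shows "(A * B) $$ (i,j) = (\<Sum>l<k. A $$ (i,l) * B $$ (l,j))"
  using assms by (simp add: scalar_prod_def lessThan_atLeast0)

lemma mtrace_mult:
  assumes "A \<in> carrier_mat n m" "B \<in> carrier_mat m n"
  shows "mtrace (A * B) = (\<Sum>i<n. \<Sum>j<m. A $$ (i,j) * B $$ (j,i))"
  unfolding mtrace_def using assms
  by (intro sum.cong) (auto simp: index_mult_mat_sum[OF assms] simp del: index_mult_mat(1))

lemma mtrace_mult_commute:
  assumes "A \<in> carrier_mat n m" "B \<in> carrier_mat m n"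
  shows "mtrace (A * B) = mtrace (B * A)"
  unfolding mtrace_mult[OF assms] mtrace_mult[OF assms(2,1)]
  by (subst sum.swap) (simp add: mult.commute)

lemma mtrace_schur_complement_mult:
  assumes A: "psd n A" and k: "k < n" and B: "B \<in> carrier_mat n n"
  shows "mtrace (A * B) = mtrace (schur_complement A k * B) + qform B (col A k) / A $$ (k,k)"
proof -
  have carrier: "A \<in> carrier_mat n n" "schur_complement A k \<in> carrier_mat n n"
    using psd_carrier[OF A] psd_carrier[OF psd_schur_complement[OF A k]] by auto
  have herm: "cnj (A $$ (j,i)) = A $$ (i,j)" if "i < n" "j < n" for i j
    using that adj_eq_self_iff[OF carrier(1)] A by (simp add: psd_def)
  have "qform B (col A k) = (\<Sum>i<n. \<Sum>j<n. A $$ (i,k) * A $$ (k,j) * B $$ (j,i))"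
    unfolding qform_eq_sesq[OF B col_carrier_vec[OF k carrier(1)]]
    using carrier B k by (subst sum.swap) (simp add: sesq_def herm mult_ac)
  then show ?thesis
    unfolding mtrace_mult[OF carrier(1) B] mtrace_mult[OF carrier(2) B]
    using carrier(1)
    by (simp add: schur_complement_def algebra_simps sum_subtractf sum_divide_distrib)
qed

text \<open>Passing to the Schur complement splits off a rank-one term and shrinks the support
  of \<open>A\<close> by one index.\<close>
lemma mtrace_mult_nonneg_supported:
  assumes "psd n A" "psd n B" "k \<le> n"
    and "\<And>i j. i < n \<Longrightarrow> j < n \<Longrightarrow> k \<le> i \<or> k \<le> j \<Longrightarrow> A $$ (i,j) = 0"
  shows "0 \<le> mtrace (A * B)"
  using assms
proof (induction k arbitrary: A)
  case 0
  then show ?case by (simp add: mtrace_mult[OF psd_carrier psd_carrier])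
next
  case (Suc k)
  note A = \<open>psd n A\<close> and B = \<open>psd n B\<close>
  let ?S = "schur_complement A k"
  have k: "k < n" using Suc.prems(3) by simp
  have "?S $$ (i,j) = 0" if ij: "i < n" "j < n" "k \<le> i \<or> k \<le> j" for i j
  proof (cases "i = k \<or> j = k")
    case True
    then show ?thesis using schur_complement_index_eq_0[OF A] ij by blast
  next
    case False
    with ij have "Suc k \<le> i \<or> Suc k \<le> j" by auto
    then show ?thesis
      using Suc.prems(4) ij k psd_carrier[OF A] by (auto simp: schur_complement_def)
  qed
  then have "0 \<le> mtrace (?S * B)"
    using Suc.IH psd_schur_complement[OF A k] B k by simp
  moreover have "0 \<le> qform B (col A k) / A $$ (k,k)"
    using qform_nonneg[OF B col_carrier_vec[OF k psd_carrier[OF A]]] psd_diag_nonneg[OF A k]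
    by (simp add: less_eq_complex_def Re_divide Im_divide)
  ultimately show ?case
    by (simp add: mtrace_schur_complement_mult[OF A k psd_carrier[OF B]])
qed

lemma mtrace_mult_psd_nonneg:
  assumes "psd n A" "psd n B"
  shows "0 \<le> mtrace (A * B)"
  by (rule mtrace_mult_nonneg_supported[OF assms order.refl]) auto

lemma psd_smult:
  assumes A: "psd n A" and "0 \<le> c"
  shows "psd n (c \<cdot>\<^sub>m A)"
proof -
  have "qform (c \<cdot>\<^sub>m A) v = c * qform A v" if "v \<in> carrier_vec n" for v
    using that psd_carrier[OF A]
    by (simp add: qform_def scalar_prod_def sum_distrib_left mult_ac)
  then show ?thesis
    using A \<open>0 \<le> c\<close> by (auto simp: psd_iff_qform_nonneg)
qed

lemma mtrace_smult: "A \<in> carrier_mat n n \<Longrightarrow> mtrace (c \<cdot>\<^sub>m A) = c * mtrace A"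
  by (simp add: mtrace_def sum_distrib_left)

section \<open>Eigenvalues and entropy\<close>

definition eigenvalue_mset :: "complex mat \<Rightarrow> complex multiset" where
  "eigenvalue_mset A = proots (char_poly A)"

lemma char_poly_nonzero: "(A :: complex mat) \<in> carrier_mat n n \<Longrightarrow> char_poly A \<noteq> 0"
  using degree_monic_char_poly by force

lemma in_eigenvalue_mset_iff:
  assumes "A \<in> carrier_mat n n"
  shows "x \<in># eigenvalue_mset A \<longleftrightarrow> eigenvalue A x"
  using char_poly_nonzero[OF assms] eigenvalue_root_char_poly[OF assms]
  by (simp add: eigenvalue_mset_def)

lemma eigenvalue_mset_similar: "similar_mat A B \<Longrightarrow> eigenvalue_mset A = eigenvalue_mset B"
  by (simp add: eigenvalue_mset_def char_poly_similar)

lemma eigenvalue_mset_upper_triangular: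
  assumes "A \<in> carrier_mat n n" "upper_triangular A"
  shows "eigenvalue_mset A = mset (diag_mat A)"
proof -
  have "proots (\<Prod>a\<leftarrow>as. [:- a, 1:]) = mset as" for as :: "complex list"
  proof (induction as)
    case (Cons a as)
    have "(\<Prod>a\<leftarrow>as. [:- a, 1:]) \<noteq> 0" by (auto simp: prod_list_zero_iff)
    with Cons show ?case by (simp add: proots_mult del: mult_pCons_left)
  qed simp
  then show ?thesis
    by (simp add: eigenvalue_mset_def char_poly_upper_triangular[OF assms])
qed

lemma complex_mat_triangularizable:
  assumes "(A :: complex mat) \<in> carrier_mat n n"
  obtains B where "B \<in> carrier_mat n n" "upper_triangular B" "similar_mat A B"
  using char_poly_factorized[OF assms] schur_decomposition_exists[OF assms] by blast

lemma mtrace_similar: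
  assumes "similar_mat A B"
  shows "mtrace A = mtrace B"
proof -
  obtain n P Q where similar: "{A, B, P, Q} \<subseteq> carrier_mat n n" "Q * P = 1\<^sub>m n" "A = P * B * Q"
    using similar_matD[OF assms] by blast
  then have carrier: "B \<in> carrier_mat n n" "P \<in> carrier_mat n n" "Q \<in> carrier_mat n n" by auto
  have "mtrace A = mtrace (Q * (P * B))"
    unfolding similar(3) using carrier by (intro mtrace_mult_commute) auto
  also have "Q * (P * B) = B"
    using carrier similar(2) by (simp flip: assoc_mult_mat[of Q n n P n B n])
  finally show ?thesis .
qed

lemma sum_eigenvalue_mset:
  assumes "A \<in> carrier_mat n n"
  shows "sum_mset (eigenvalue_mset A) = mtrace A"
proof -
  obtain B where B: "B \<in> carrier_mat n n" "upper_triangular B" "similar_mat A B"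
    using complex_mat_triangularizable[OF assms] .
  have "sum_mset (eigenvalue_mset A) = sum_list (diag_mat B)"
    using eigenvalue_mset_similar[OF B(3)] eigenvalue_mset_upper_triangular[OF B(1,2)]
    by (simp add: sum_mset_sum_list)
  also have "\<dots> = mtrace B"
    by (simp add: diag_mat_def mtrace_def interv_sum_list_conv_sum_set_nat lessThan_atLeast0)
  finally show ?thesis using mtrace_similar[OF B(3)] by simp
qed

lemma eigenvalue_mset_smult:
  assumes "A \<in> carrier_mat n n"
  shows "eigenvalue_mset (c \<cdot>\<^sub>m A) = image_mset ((*) c) (eigenvalue_mset A)"
proof -
  obtain B where B: "B \<in> carrier_mat n n" "upper_triangular B" "similar_mat A B"
    using complex_mat_triangularizable[OF assms] .
  have "upper_triangular (c \<cdot>\<^sub>m B)" using B by (auto simp: upper_triangular_def)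
  then have "eigenvalue_mset (c \<cdot>\<^sub>m A) = mset (diag_mat (c \<cdot>\<^sub>m B))"
    using B eigenvalue_mset_similar[OF similar_mat_smult[OF B(3)]]
      eigenvalue_mset_upper_triangular[of "c \<cdot>\<^sub>m B" n] by simp
  also have "diag_mat (c \<cdot>\<^sub>m B) = map ((*) c) (diag_mat B)"
    using B(1) by (auto simp: diag_mat_def)
  finally show ?thesis
    using eigenvalue_mset_similar[OF B(3)] eigenvalue_mset_upper_triangular[OF B(1,2)] by simp
qed

lemma psd_eigenvalue_nonneg:
  assumes A: "psd n A" and "x \<in># eigenvalue_mset A"
  shows "0 \<le> x"
proof -
  have carrier: "A \<in> carrier_mat n n" using A by (rule psd_carrier)
  obtain v where v: "v \<in> carrier_vec n" "v \<noteq> 0\<^sub>v n" "A *\<^sub>v v = x \<cdot>\<^sub>v v"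
    using assms(2) in_eigenvalue_mset_iff[OF carrier] carrier
    unfolding eigenvalue_def eigenvector_def by auto
  have "qform A v = x * (v \<bullet>c v)"
    unfolding qform_def v(3) using v(1)
    by (simp add: scalar_prod_def lessThan_atLeast0 sum_distrib_left mult_ac)
  moreover have "0 < v \<bullet>c v" using v conjugate_square_greater_0_vec by blast
  ultimately show ?thesis
    using qform_nonneg[OF A v(1)]
    by (auto simp: less_eq_complex_def less_complex_def zero_le_mult_iff)
qed

definition eta :: "real \<Rightarrow> real" where
  "eta x = - (x * ln x)"

lemma eta_nonneg: "0 \<le> x \<Longrightarrow> x \<le> 1 \<Longrightarrow> 0 \<le> eta x"
  by (cases "x = 0") (auto simp: eta_def mult_nonneg_nonpos)

lemma eta_mult: "0 \<le> x \<Longrightarrow> 0 \<le> y \<Longrightarrow> eta (x * y) = x * eta y + y * eta x"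
  by (cases "x = 0 \<or> y = 0") (auto simp: eta_def ln_mult algebra_simps)

lemma sum_image_mset_eq_sum_count:
  fixes f :: "'a \<Rightarrow> 'b :: semiring_1"
  shows "(\<Sum>x\<in>#M. f x) = (\<Sum>x\<in>set_mset M. of_nat (count M x) * f x)"
proof (induction M)
  case (add y M)
  have "(\<Sum>x\<in>set_mset (add_mset y M). of_nat (count (add_mset y M) x) * f x)
      = (\<Sum>x\<in>insert y (set_mset M). (if x = y then f y else 0) + of_nat (count M x) * f x)"
    by (intro sum.cong) (auto simp: distrib_right)
  also have "\<dots> = f y + (\<Sum>x\<in>insert y (set_mset M). of_nat (count M x) * f x)"
    by (simp add: sum.distrib)
  also have "(\<Sum>x\<in>insert y (set_mset M). of_nat (count M x) * f x)
      = (\<Sum>x\<in>set_mset M. of_nat (count M x) * f x)"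
    by (intro sum.mono_neutral_right) (auto simp: not_in_iff[THEN iffD1])
  finally show ?case using add by simp
qed simp

lemma vn_entropy_eigenvalue_mset:
  assumes "A \<in> carrier_mat n n"
  shows "vn_entropy A = (\<Sum>x\<in>#eigenvalue_mset A. eta (Re x))"
proof -
  let ?p = "char_poly A"
  have "vn_entropy A = (\<Sum>x | poly ?p x = 0. of_nat (Polynomial.order x ?p) * eta (Re x))"
    unfolding vn_entropy_def sum_negf[symmetric] by (intro sum.cong) (auto simp: eta_def)
  then show ?thesis
    using char_poly_nonzero[OF assms] by (simp add: sum_image_mset_eq_sum_count eigenvalue_mset_def)
qed

lemma vn_entropy_similar:
  assumes "similar_mat A B"
  shows "vn_entropy A = vn_entropy B"
  by (simp add: vn_entropy_def char_poly_similar[OF assms])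

lemma sum_Re_eigenvalue_mset:
  assumes "A \<in> carrier_mat n n"
  shows "(\<Sum>x\<in>#eigenvalue_mset A. Re x) = Re (mtrace A)"
proof -
  have "(\<Sum>x\<in>#E. Re x) = Re (sum_mset E)" for E by (induction E) auto
  then show ?thesis by (simp add: sum_eigenvalue_mset[OF assms])
qed

lemma vn_entropy_density_nonneg:
  assumes A: "density n A"
  shows "0 \<le> vn_entropy A"
proof -
  have psd: "psd n A" and trace_one: "mtrace A = 1" using A by (auto simp: density_def)
  note carrier = psd_carrier[OF psd]
  have "0 \<le> eta (Re x)" if x: "x \<in># eigenvalue_mset A" for x
  proof (rule eta_nonneg)
    have nonneg: "0 \<le> Re y" if "y \<in># eigenvalue_mset A" for y
      using psd_eigenvalue_nonneg[OF psd that] by (simp add: less_eq_complex_def)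
    then show "0 \<le> Re x" using x .
    have "Re x + (\<Sum>y\<in>#eigenvalue_mset A - {#x#}. Re y) = 1"
      using sum_Re_eigenvalue_mset[OF carrier] trace_one x by (simp flip: sum_mset.insert)
    moreover have "0 \<le> (\<Sum>y\<in>#eigenvalue_mset A - {#x#}. Re y)"
      using sum_mset_mono[of "eigenvalue_mset A - {#x#}" "\<lambda>_. 0" Re] nonneg by (auto dest: in_diffD)
    ultimately show "Re x \<le> 1" by simp
  qed
  then show ?thesis
    using sum_mset_mono[of "eigenvalue_mset A" "\<lambda>_. 0" "\<lambda>x. eta (Re x)"]
    by (simp add: vn_entropy_eigenvalue_mset[OF carrier])
qed

lemma vn_entropy_smult:
  assumes A: "psd n A" and c: "0 \<le> c"
  shows "vn_entropy (of_real c \<cdot>\<^sub>m A) = c * vn_entropy A + eta c * Re (mtrace A)"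
proof -
  note carrier = psd_carrier[OF A]
  have "vn_entropy (of_real c \<cdot>\<^sub>m A) = (\<Sum>x\<in>#eigenvalue_mset A. eta (c * Re x))"
    using vn_entropy_eigenvalue_mset[OF smult_carrier_mat[OF carrier]]
    by (simp add: eigenvalue_mset_smult[OF carrier] image_mset.compositionality o_def)
  also have "\<dots> = (\<Sum>x\<in>#eigenvalue_mset A. c * eta (Re x) + eta c * Re x)"
    using psd_eigenvalue_nonneg[OF A] c
    by (intro arg_cong[of _ _ sum_mset] image_mset_cong) (simp add: eta_mult less_eq_complex_def)
  also have "\<dots> = c * (\<Sum>x\<in>#eigenvalue_mset A. eta (Re x)) + eta c * (\<Sum>x\<in>#eigenvalue_mset A. Re x)"
    by (simp only: sum_mset.distrib sum_mset_distrib_left)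
  finally show ?thesis
    by (simp only: sum_Re_eigenvalue_mset[OF carrier] vn_entropy_eigenvalue_mset[OF carrier])
qed

section \<open>Tensor products and partial traces\<close>

lemma sum_lessThan_mult:
  fixes d m :: nat
  shows "(\<Sum>p<d * m. f p) = (\<Sum>i<d. \<Sum>k<m. f (i * m + k))"
proof -
  have "sum f {i * m..<i * m + m} = (\<Sum>k<m. f (i * m + k))" for i
    using sum.shift_bounds_nat_ivl[of f 0 "i * m" m] by (simp add: lessThan_atLeast0 add.commute)
  then show ?thesis by (simp flip: sum.nat_group)
qed

lemma div_mod_less_mult:
  assumes "p < d * m"
  shows "p div m < d" "p mod m < (m :: nat)"
  using assms by (auto simp: less_mult_imp_div_less intro!: mod_less_divisor gr_zeroI)

lemma mult_add_less_mult:
  fixes d m i k :: nat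
  assumes "i < d" "k < m"
  shows "i * m + k < d * m"
proof -
  have "i * m + k < Suc i * m" using assms by simp
  also have "\<dots> \<le> d * m" using assms by (intro mult_le_mono1) simp
  finally show ?thesis .
qed

definition mat_lincomb ::
    "nat \<Rightarrow> 's set \<Rightarrow> ('s \<Rightarrow> complex) \<Rightarrow> ('s \<Rightarrow> complex mat) \<Rightarrow> complex mat" where
  "mat_lincomb n S c Y = mat n n (\<lambda>ij. \<Sum>s\<in>S. c s * Y s $$ ij)"

lemma mat_lincomb_carrier [simp]: "mat_lincomb n S c Y \<in> carrier_mat n n"
  by (simp add: mat_lincomb_def)

lemma mtrace_mat_lincomb:
  assumes "\<And>s. s \<in> S \<Longrightarrow> Y s \<in> carrier_mat n n"
  shows "mtrace (mat_lincomb n S c Y) = (\<Sum>s\<in>S. c s * mtrace (Y s))"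
proof -
  have "mtrace (mat_lincomb n S c Y) = (\<Sum>s\<in>S. \<Sum>i<n. c s * Y s $$ (i,i))"
    by (subst sum.swap) (simp add: mtrace_def mat_lincomb_def)
  then show ?thesis using assms by (auto simp: mtrace_def sum_distrib_left intro!: sum.cong)
qed

lemma qform_mat_lincomb:
  assumes Y: "\<And>s. s \<in> S \<Longrightarrow> Y s \<in> carrier_mat n n" and v: "v \<in> carrier_vec n"
  shows "qform (mat_lincomb n S c Y) v = (\<Sum>s\<in>S. c s * qform (Y s) v)"
proof -
  have "qform (mat_lincomb n S c Y) v
      = (\<Sum>i<n. \<Sum>j<n. \<Sum>s\<in>S. c s * (cnj (v $ i) * Y s $$ (i,j) * v $ j))"
    unfolding qform_eq_sesq[OF mat_lincomb_carrier v]
    by (simp add: sesq_def mat_lincomb_def sum_distrib_left sum_distrib_right mult_ac)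
  also have "\<dots> = (\<Sum>s\<in>S. \<Sum>i<n. \<Sum>j<n. c s * (cnj (v $ i) * Y s $$ (i,j) * v $ j))"
    by (simp add: sum.swap[of _ S])
  also have "\<dots> = (\<Sum>s\<in>S. c s * qform (Y s) v)"
    using carrier_matD[OF Y]
    by (intro sum.cong refl) (simp add: qform_eq_sesq[OF Y v] sesq_def sum_distrib_left)
  finally show ?thesis .
qed

lemma psd_mat_lincomb:
  assumes "\<And>s. s \<in> S \<Longrightarrow> 0 \<le> c s" "\<And>s. s \<in> S \<Longrightarrow> psd n (Y s)"
  shows "psd n (mat_lincomb n S c Y)"
  using assms qform_nonneg[OF assms(2)]
  by (simp add: psd_iff_qform_nonneg qform_mat_lincomb psd_carrier sum_nonneg)

definition kron :: "complex mat \<Rightarrow> complex mat \<Rightarrow> complex mat" where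
  "kron A B = mat (dim_row A * dim_row B) (dim_col A * dim_col B) (\<lambda>(p,q).
     A $$ (p div dim_row B, q div dim_col B) * B $$ (p mod dim_row B, q mod dim_col B))"

lemma kron_carrier:
  "A \<in> carrier_mat a b \<Longrightarrow> B \<in> carrier_mat c d \<Longrightarrow> kron A B \<in> carrier_mat (a * c) (b * d)"
  by (simp add: kron_def)

lemma kron_index:
  assumes "A \<in> carrier_mat a b" "B \<in> carrier_mat c d" "p < a * c" "q < b * d"
  shows "kron A B $$ (p,q) = A $$ (p div c, q div d) * B $$ (p mod c, q mod d)"
  using assms by (simp add: kron_def)

lemma kron_one: "kron (1\<^sub>m n) (1\<^sub>m m) = 1\<^sub>m (n * m)"
proof (rule eq_matI)
  fix p q assume "p < dim_row (1\<^sub>m (n * m))" "q < dim_col (1\<^sub>m (n * m))"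
  then have pq: "p < n * m" "q < n * m" by auto
  have "p = q \<longleftrightarrow> p div m = q div m \<and> p mod m = q mod m" by (metis div_mult_mod_eq)
  then show "kron (1\<^sub>m n) (1\<^sub>m m) $$ (p,q) = 1\<^sub>m (n * m) $$ (p,q)"
    using pq div_mod_less_mult[OF pq(1)] div_mod_less_mult[OF pq(2)] by (simp add: kron_def)
qed (auto simp: kron_def)

lemma kron_mult:
  assumes A: "A \<in> carrier_mat a b" and B: "B \<in> carrier_mat c d"
    and A': "A' \<in> carrier_mat b a'" and B': "B' \<in> carrier_mat d c'"
  shows "kron A B * kron A' B' = kron (A * A') (B * B')"
proof (rule eq_matI)
  fix p q assume "p < dim_row (kron (A * A') (B * B'))" "q < dim_col (kron (A * A') (B * B'))"
  then have pq: "p < a * c" "q < a' * c'" using assms by (auto simp: kron_def)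
  note div_mod = div_mod_less_mult[OF pq(1)] div_mod_less_mult[OF pq(2)]
  have "(kron A B * kron A' B') $$ (p,q) = (\<Sum>r<b * d. kron A B $$ (p,r) * kron A' B' $$ (r,q))"
    by (rule index_mult_mat_sum[OF kron_carrier[OF A B] kron_carrier[OF A' B'] pq])
  also have "\<dots> = (\<Sum>j<b. \<Sum>l<d. (A $$ (p div c, j) * A' $$ (j, q div c'))
      * (B $$ (p mod c, l) * B' $$ (l, q mod c')))"
    unfolding sum_lessThan_mult using pq
    by (simp add: kron_index[OF A B] kron_index[OF A' B'] mult_add_less_mult mult_ac)
  also have "\<dots> = kron (A * A') (B * B') $$ (p,q)"
    using assms pq div_mod by (simp add: kron_def scalar_prod_def lessThan_atLeast0 sum_product)
  finally show "(kron A B * kron A' B') $$ (p,q) = kron (A * A') (B * B') $$ (p,q)" .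
qed (use assms in \<open>auto simp: kron_def\<close>)

lemma sum_kron_one_row:
  assumes A: "A \<in> carrier_mat a b" and p: "p < a * m"
  shows "(\<Sum>r<b * m. kron A (1\<^sub>m m) $$ (p,r) * f r)
    = (\<Sum>j<b. A $$ (p div m, j) * f (j * m + p mod m))"
proof -
  have "(\<Sum>r<b * m. kron A (1\<^sub>m m) $$ (p,r) * f r)
      = (\<Sum>j<b. \<Sum>k<m. if k = p mod m then A $$ (p div m, j) * f (j * m + p mod m) else 0)"
    unfolding sum_lessThan_mult using p div_mod_less_mult[OF p]
    by (intro sum.cong refl) (auto simp: kron_index[OF A one_carrier_mat] mult_add_less_mult)
  then show ?thesis using div_mod_less_mult[OF p] by simp
qed

lemma kron_one_mult_index:
  assumes A: "A \<in> carrier_mat a b" and X: "X \<in> carrier_mat (b * m) N" and pq: "p < a * m" "q < N"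
  shows "(kron A (1\<^sub>m m) * X) $$ (p,q) = (\<Sum>j<b. A $$ (p div m, j) * X $$ (j * m + p mod m, q))"
proof -
  have "(kron A (1\<^sub>m m) * X) $$ (p,q) = (\<Sum>r<b * m. kron A (1\<^sub>m m) $$ (p,r) * X $$ (r,q))"
    by (rule index_mult_mat_sum[OF kron_carrier[OF A one_carrier_mat] X pq])
  then show ?thesis by (simp only: sum_kron_one_row[OF A pq(1)])
qed

definition block :: "nat \<Rightarrow> complex mat \<Rightarrow> nat \<Rightarrow> nat \<Rightarrow> complex mat" where
  "block m X i j = mat m m (\<lambda>(k,l). X $$ (i * m + k, j * m + l))"

lemma block_carrier [simp]: "block m X i j \<in> carrier_mat m m"
  by (simp add: block_def)

lemma block_index [simp]:
  "k < m \<Longrightarrow> l < m \<Longrightarrow> block m X i j $$ (k,l) = X $$ (i * m + k, j * m + l)"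
  by (simp add: block_def)

lemma qform_block:
  assumes v: "v \<in> carrier_vec m"
  shows "qform (block m X i j) v
    = (\<Sum>k<m. \<Sum>l<m. cnj (v $ k) * X $$ (i * m + k, j * m + l) * v $ l)"
  unfolding qform_eq_sesq[OF block_carrier v]
  by (simp add: sesq_def carrier_matD[OF block_carrier])

definition tensor_vec :: "complex vec \<Rightarrow> complex vec \<Rightarrow> complex vec" where
  "tensor_vec u v = vec (dim_vec u * dim_vec v)
     (\<lambda>p. u $ (p div dim_vec v) * v $ (p mod dim_vec v))"

text \<open>The operator \<open>(I \<otimes> \<langle>v|) X (I \<otimes> |v\<rangle>)\<close>.\<close>
definition compress :: "nat \<Rightarrow> nat \<Rightarrow> complex vec \<Rightarrow> complex mat \<Rightarrow> complex mat" where
  "compress d m v X = mat d d (\<lambda>(i,j). qform (block m X i j) v)"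

lemma qform_compress:
  assumes X: "X \<in> carrier_mat (d * m) (d * m)" and u: "u \<in> carrier_vec d" and v: "v \<in> carrier_vec m"
  shows "qform (compress d m v X) u = qform X (tensor_vec u v)"
proof -
  let ?x = "\<lambda>i k j l. cnj (u $ i * v $ k) * X $$ (i * m + k, j * m + l) * (u $ j * v $ l)"
  have uv: "tensor_vec u v \<in> carrier_vec (d * m)" using u v by (auto simp: tensor_vec_def)
  have "qform (compress d m v X) u = (\<Sum>i<d. \<Sum>j<d. \<Sum>k<m. \<Sum>l<m. ?x i k j l)"
    using u by (simp add: qform_eq_sesq[of _ d] qform_block[OF v] compress_def sesq_def
        sum_distrib_left sum_distrib_right mult_ac)
  also have "\<dots> = (\<Sum>i<d. \<Sum>k<m. \<Sum>j<d. \<Sum>l<m. ?x i k j l)"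
    by (intro sum.cong refl sum.swap)
  also have "\<dots> = qform X (tensor_vec u v)"
    using u v X unfolding qform_eq_sesq[OF X uv]
    by (simp add: sesq_def sum_lessThan_mult tensor_vec_def mult_add_less_mult)
  finally show ?thesis .
qed

lemma psd_compress:
  assumes X: "psd (d * m) X" and v: "v \<in> carrier_vec m"
  shows "psd d (compress d m v X)"
  unfolding psd_iff_qform_nonneg
proof (intro conjI ballI)
  fix u :: "complex vec" assume u: "u \<in> carrier_vec d"
  have "tensor_vec u v \<in> carrier_vec (d * m)" using u v by (auto simp: tensor_vec_def)
  then show "0 \<le> qform (compress d m v X) u"
    using qform_nonneg[OF X] qform_compress[OF psd_carrier[OF X] u v] by simp
qed (simp add: compress_def)

lemma ptrace2_eq_mat_lincomb:
  "ptrace2 d m X = mat_lincomb d {..<m} (\<lambda>_. 1) (\<lambda>k. compress d m (unit_vec m k) X)"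
  by (rule eq_matI)
    (auto simp: ptrace2_def mat_lincomb_def compress_def qform_unit_vec[OF block_carrier])

lemma mtrace_ptrace1:
  assumes "X \<in> carrier_mat (d * m) (d * m)"
  shows "mtrace (ptrace1 d m X) = mtrace X"
  using assms by (simp add: mtrace_def ptrace1_def sum_lessThan_mult sum.swap[of _ "{..<m}"])

lemma mtrace_ptrace2:
  assumes "X \<in> carrier_mat (d * m) (d * m)"
  shows "mtrace (ptrace2 d m X) = mtrace X"
  using assms by (simp add: mtrace_def ptrace2_def sum_lessThan_mult)

lemma ptrace1_carrier [simp]: "ptrace1 d m X \<in> carrier_mat m m"
  by (simp add: ptrace1_def)

lemma ptrace2_carrier [simp]: "ptrace2 d m X \<in> carrier_mat d d"
  by (simp add: ptrace2_def)

definition cond_op :: "nat \<Rightarrow> nat \<Rightarrow> complex mat \<Rightarrow> complex mat \<Rightarrow> complex mat" where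
  "cond_op d m A X = ptrace1 d m (kron A (1\<^sub>m m) * X)"

lemma cond_op_carrier [simp]: "cond_op d m A X \<in> carrier_mat m m"
  by (simp add: cond_op_def)

lemma cond_op_index:
  assumes A: "A \<in> carrier_mat d d" and X: "X \<in> carrier_mat (d * m) (d * m)" and "k < m" "l < m"
  shows "cond_op d m A X $$ (k,l) = (\<Sum>i<d. \<Sum>j<d. A $$ (i,j) * X $$ (j * m + k, i * m + l))"
  using assms(3,4)
  by (simp add: cond_op_def ptrace1_def kron_one_mult_index[OF A X] mult_add_less_mult
      del: index_mult_mat(1))

lemma cond_op_eq_mat_lincomb:
  assumes A: "A \<in> carrier_mat d d" and X: "X \<in> carrier_mat (d * m) (d * m)"
  shows "cond_op d m A X
    = mat_lincomb m ({..<d} \<times> {..<d}) (\<lambda>(i,j). A $$ (i,j)) (\<lambda>(i,j). block m X j i)"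
  by (rule eq_matI)
    (auto simp: cond_op_index[OF A X] carrier_matD[OF cond_op_carrier] mat_lincomb_def
      sum.cartesian_product intro!: sum.cong)

lemma psd_cond_op:
  assumes A: "psd d A" and X: "psd (d * m) X"
  shows "psd m (cond_op d m A X)"
  unfolding psd_iff_qform_nonneg
proof (intro conjI ballI cond_op_carrier)
  fix v :: "complex vec" assume v: "v \<in> carrier_vec m"
  have compress: "compress d m v X \<in> carrier_mat d d" by (simp add: compress_def)
  have "qform (cond_op d m A X) v = (\<Sum>(i,j)\<in>{..<d} \<times> {..<d}. A $$ (i,j) * qform (block m X j i) v)"
    unfolding cond_op_eq_mat_lincomb[OF psd_carrier[OF A] psd_carrier[OF X]]
    by (subst qform_mat_lincomb[OF _ v]) (auto simp: split_def)
  also have "\<dots> = mtrace (A * compress d m v X)"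
    unfolding mtrace_mult[OF psd_carrier[OF A] compress]
    by (simp add: compress_def sum.cartesian_product)
  finally show "0 \<le> qform (cond_op d m A X) v"
    using mtrace_mult_psd_nonneg[OF A psd_compress[OF X v]] by simp
qed

lemma mtrace_cond_op:
  assumes A: "A \<in> carrier_mat d d" and X: "X \<in> carrier_mat (d * m) (d * m)"
  shows "mtrace (cond_op d m A X) = mtrace (A * ptrace2 d m X)"
proof -
  have "mtrace (cond_op d m A X) = (\<Sum>i<d. \<Sum>j<d. A $$ (i,j) * mtrace (block m X j i))"
    unfolding cond_op_eq_mat_lincomb[OF assms]
    by (subst mtrace_mat_lincomb) (auto simp: split_def sum.cartesian_product)
  also have "\<dots> = mtrace (A * ptrace2 d m X)"
    unfolding mtrace_mult[OF A ptrace2_carrier] by (simp add: ptrace2_def mtrace_def block_def)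
  finally show ?thesis .
qed

lemma psd_one: "psd n (1\<^sub>m n)"
  unfolding psd_iff_qform_nonneg
proof (intro conjI ballI one_carrier_mat)
  fix v :: "complex vec" assume v: "v \<in> carrier_vec n"
  then have "qform (1\<^sub>m n) v = v \<bullet>c v"
    by (simp add: qform_def scalar_prod_def lessThan_atLeast0 mult.commute)
  then show "0 \<le> qform (1\<^sub>m n) v" by (simp add: conjugate_square_ge_0_vec)
qed

lemma cond_op_one:
  assumes "X \<in> carrier_mat (d * m) (d * m)"
  shows "cond_op d m (1\<^sub>m d) X = ptrace1 d m X"
  using assms by (simp add: cond_op_def kron_one)

lemma density_ptrace1:
  assumes X: "density (d * m) X"
  shows "density m (ptrace1 d m X)"
proof -
  have psd: "psd (d * m) X" using X by (simp add: density_def)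
  then have "psd m (ptrace1 d m X)"
    using psd_cond_op[OF psd_one] cond_op_one[OF psd_carrier[OF psd]] by metis
  then show ?thesis
    using X mtrace_ptrace1[OF psd_carrier[OF psd]] by (simp add: density_def)
qed

lemma density_ptrace2:
  assumes X: "density (d * m) X"
  shows "density d (ptrace2 d m X)"
proof -
  have psd: "psd (d * m) X" using X by (simp add: density_def)
  then have "psd d (ptrace2 d m X)"
    unfolding ptrace2_eq_mat_lincomb
    by (intro psd_mat_lincomb psd_compress) (auto simp: less_eq_complex_def)
  then show ?thesis
    using X mtrace_ptrace2[OF psd_carrier[OF psd]] by (simp add: density_def)
qed

section \<open>Entropy of block diagonal matrices and unitary invariance\<close>

lemma vn_entropy_four_block_diag:
  assumes A: "A \<in> carrier_mat n n" and B: "B \<in> carrier_mat m m"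
  shows "vn_entropy (four_block_mat A (0\<^sub>m n m) (0\<^sub>m m n) B) = vn_entropy A + vn_entropy B"
proof -
  let ?C = "four_block_mat A (0\<^sub>m n m) (0\<^sub>m m n) B"
  have "char_poly ?C = char_poly A * char_poly B"
    using char_poly_factorized[OF A] char_poly_factorized[OF B]
    by (intro char_poly_0_block[OF refl _ _ A _ B]) auto
  then have "eigenvalue_mset ?C = eigenvalue_mset A + eigenvalue_mset B"
    using char_poly_nonzero[OF A] char_poly_nonzero[OF B]
    by (simp add: eigenvalue_mset_def proots_mult)
  then show ?thesis
    using vn_entropy_eigenvalue_mset[OF four_block_carrier_mat[OF A B]]
    by (simp add: vn_entropy_eigenvalue_mset[OF A] vn_entropy_eigenvalue_mset[OF B])
qed

definition block_diag :: "nat \<Rightarrow> nat \<Rightarrow> (nat \<Rightarrow> complex mat) \<Rightarrow> complex mat" where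
  "block_diag d m B = mat (d * m) (d * m) (\<lambda>(p,q).
     if p div m = q div m then B (p div m) $$ (p mod m, q mod m) else 0)"

lemma block_diag_carrier [simp]: "block_diag d m B \<in> carrier_mat (d * m) (d * m)"
  by (simp add: block_diag_def)

lemma block_diag_index:
  assumes "i < d" "j < d" "k < m" "l < m"
  shows "block_diag d m B $$ (i * m + k, j * m + l) = (if i = j then B i $$ (k,l) else 0)"
  using assms by (simp add: block_diag_def mult_add_less_mult)

lemma block_diag_Suc:
  assumes B: "B d \<in> carrier_mat m m"
  shows "block_diag (Suc d) m B
    = four_block_mat (block_diag d m B) (0\<^sub>m (d * m) m) (0\<^sub>m m (d * m)) (B d)" (is "_ = ?F")
proof (rule eq_matI)
  fix p q assume "p < dim_row ?F" "q < dim_col ?F"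
  then have pq: "p < d * m + m" "q < d * m + m" using B by (auto simp: block_diag_def)
  have last: "r div m = d \<and> r mod m = r - d * m" if "\<not> r < d * m" "r < d * m + m" for r
  proof -
    have "r div m = d" using that by (intro div_nat_eqI) (auto simp: mult.commute)
    then show ?thesis using minus_div_mult_eq_mod[of r m] by simp
  qed
  have "r div m \<noteq> d" if "r < d * m" for r
    using div_mod_less_mult(1)[OF that] by simp
  then show "block_diag (Suc d) m B $$ (p,q) = ?F $$ (p,q)"
    using B pq last[of p] last[of q] by (auto simp: block_diag_def)
qed (use B in \<open>auto simp: block_diag_def\<close>)

lemma vn_entropy_block_diag:
  assumes "\<And>j. j < d \<Longrightarrow> B j \<in> carrier_mat m m"
  shows "vn_entropy (block_diag d m B) = (\<Sum>j<d. vn_entropy (B j))"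
  using assms
proof (induction d)
  case 0
  have "char_poly (block_diag 0 m B) = 1" by (simp add: char_poly_defs block_diag_def)
  then show ?case by (simp add: vn_entropy_def)
next
  case (Suc d)
  then show ?case
    by (simp add: block_diag_Suc vn_entropy_four_block_diag[OF block_diag_carrier])
qed

lemma vn_entropy_mat_diag: "vn_entropy (mat_diag n f) = (\<Sum>j<n. eta (Re (f j)))"
proof -
  have "upper_triangular (mat_diag n f)" by (auto simp: mat_diag_def)
  moreover have "diag_mat (mat_diag n f) = map f [0..<n]" by (auto simp: diag_mat_def mat_diag_def)
  ultimately show ?thesis
    using vn_entropy_eigenvalue_mset[OF mat_diag_dim]
      eigenvalue_mset_upper_triangular[OF mat_diag_dim]
    by (simp add: sum_mset_sum_list interv_sum_list_conv_sum_set_nat lessThan_atLeast0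
        flip: mset_map)
qed

definition unitary :: "nat \<Rightarrow> complex mat \<Rightarrow> bool" where
  "unitary n U \<longleftrightarrow> U \<in> carrier_mat n n \<and> adj U * U = 1\<^sub>m n \<and> U * adj U = 1\<^sub>m n"

lemma adj_carrier: "A \<in> carrier_mat n m \<Longrightarrow> adj A \<in> carrier_mat m n"
  by (simp add: adj_def)

lemma adj_kron: "adj (kron A B) = kron (adj A) (adj B)"
  by (rule eq_matI) (auto simp: adj_def kron_def div_mod_less_mult)

lemma adj_one: "adj (1\<^sub>m n) = 1\<^sub>m n"
  by (simp add: adj_eq_self_iff[of _ n])

lemma kron_one_conj_block_diag_index:
  assumes A: "A \<in> carrier_mat d d" and pq: "p < d * m" "q < d * m"
  shows "(kron A (1\<^sub>m m) * block_diag d m B * adj (kron A (1\<^sub>m m))) $$ (p,q)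
    = (\<Sum>c<d. A $$ (p div m, c) * cnj (A $$ (q div m, c)) * B c $$ (p mod m, q mod m))"
    (is "(?K * ?D * adj ?K) $$ (p,q) = _")
proof -
  note div_mod = div_mod_less_mult[OF pq(1)] div_mod_less_mult[OF pq(2)]
  have KD_index: "(?K * ?D) $$ (p, c * m + q mod m) = A $$ (p div m, c) * B c $$ (p mod m, q mod m)"
    if c: "c < d" for c
  proof -
    have "(?K * ?D) $$ (p, c * m + q mod m)
        = (\<Sum>j<d. A $$ (p div m, j) * (if j = c then B j $$ (p mod m, q mod m) else 0))"
      using pq mult_add_less_mult[OF c div_mod(4)]
      by (simp add: kron_one_mult_index[OF A block_diag_carrier]
          block_diag_index[OF _ c div_mod(2,4)] del: index_mult_mat(1))
    then show ?thesis using c by (simp add: if_distrib[of "(*) _"] cong: if_cong)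
  qed
  have K: "?K \<in> carrier_mat (d * m) (d * m)" using A by (intro kron_carrier) auto
  have "(?K * ?D * adj ?K) $$ (p,q) = (\<Sum>r<d * m. (?K * ?D) $$ (p,r) * adj ?K $$ (r,q))"
    using mult_carrier_mat[OF K block_diag_carrier] adj_carrier[OF K] pq
    by (rule index_mult_mat_sum)
  also have "\<dots> = cnj (\<Sum>r<d * m. ?K $$ (q,r) * cnj ((?K * ?D) $$ (p,r)))"
    using K pq by (simp add: adj_def mult.commute del: index_mult_mat(1))
  also have "\<dots> = (\<Sum>c<d. A $$ (p div m, c) * cnj (A $$ (q div m, c)) * B c $$ (p mod m, q mod m))"
    unfolding sum_kron_one_row[OF A pq(2)]
    by (simp add: KD_index mult_ac del: index_mult_mat(1))
  finally show ?thesis .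
qed

lemma unitary_kron_one:
  assumes "unitary n U"
  shows "unitary (n * m) (kron U (1\<^sub>m m))"
proof -
  have U: "U \<in> carrier_mat n n" "adj U \<in> carrier_mat n n"
    using assms by (auto simp: unitary_def adj_carrier)
  then show ?thesis
    using assms U kron_carrier[OF U(1) one_carrier_mat[of m]]
    by (simp add: unitary_def adj_kron adj_one kron_one
        kron_mult[OF _ one_carrier_mat _ one_carrier_mat])
qed

lemma vn_entropy_unitary_conj:
  assumes U: "unitary n U" and A: "A \<in> carrier_mat n n"
  shows "vn_entropy (U * A * adj U) = vn_entropy A"
proof (rule vn_entropy_similar)
  have "U \<in> carrier_mat n n" "adj U \<in> carrier_mat n n"
    using U by (auto simp: unitary_def adj_carrier)
  then have "{U * A * adj U, A, U, adj U} \<subseteq> carrier_mat n n" using A by simp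
  then show "similar_mat (U * A * adj U) A"
    using U by (intro similar_matI[of _ _ U "adj U" n]) (auto simp: unitary_def)
qed

definition orthonormal :: "nat \<Rightarrow> (nat \<Rightarrow> complex vec) \<Rightarrow> bool" where
  "orthonormal d e \<longleftrightarrow> (\<forall>j<d. e j \<in> carrier_vec d) \<and>
     (\<forall>i<d. \<forall>j<d. cinner (e i) (e j) = (if i = j then 1 else 0))"

definition basis_mat :: "nat \<Rightarrow> (nat \<Rightarrow> complex vec) \<Rightarrow> complex mat" where
  "basis_mat d e = mat d d (\<lambda>(i,j). e j $ i)"

lemma basis_mat_carrier [simp]: "basis_mat d e \<in> carrier_mat d d"
  by (simp add: basis_mat_def)

lemma unitary_basis_mat:
  assumes "orthonormal d e"
  shows "unitary d (basis_mat d e)"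
proof -
  let ?U = "basis_mat d e"
  have adj: "adj ?U \<in> carrier_mat d d" by (rule adj_carrier) simp
  have "adj ?U * ?U = 1\<^sub>m d"
  proof (rule eq_matI)
    fix i j assume "i < dim_row (1\<^sub>m d)" "j < dim_col (1\<^sub>m d)"
    then have ij: "i < d" "j < d" by auto
    then have "dim_vec (e j) = d" using assms by (auto simp: orthonormal_def)
    then have "(adj ?U * ?U) $$ (i,j) = cinner (e i) (e j)"
      using ij by (simp add: adj_def basis_mat_def cinner_def scalar_prod_def lessThan_atLeast0)
    then show "(adj ?U * ?U) $$ (i,j) = 1\<^sub>m d $$ (i,j)"
      using assms ij by (simp add: orthonormal_def)
  qed (auto simp: adj_def basis_mat_def)
  then show ?thesis
    using mat_mult_left_right_inverse[OF adj basis_mat_carrier] by (simp add: unitary_def)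
qed

section \<open>Linear maps and channels\<close>

lemma linear_map_carrier: "Defs.linear_map n F \<Longrightarrow> A \<in> carrier_mat n n \<Longrightarrow> F A \<in> carrier_mat n n"
  and linear_map_add: "Defs.linear_map n F \<Longrightarrow> A \<in> carrier_mat n n \<Longrightarrow> B \<in> carrier_mat n n
    \<Longrightarrow> F (A + B) = F A + F B"
  and linear_map_smult: "Defs.linear_map n F \<Longrightarrow> A \<in> carrier_mat n n \<Longrightarrow> F (c \<cdot>\<^sub>m A) = c \<cdot>\<^sub>m F A"
  by (simp_all add: Defs.linear_map_def)

lemma mat_lincomb_empty: "mat_lincomb n {} c Y = 0\<^sub>m n n"
  by (auto simp: mat_lincomb_def)

lemma mat_lincomb_insert:
  assumes "finite S" "t \<notin> S" "Y t \<in> carrier_mat n n"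
  shows "mat_lincomb n (insert t S) c Y = c t \<cdot>\<^sub>m Y t + mat_lincomb n S c Y"
  using assms by (auto simp: mat_lincomb_def intro!: eq_matI)

lemma linear_map_zero:
  assumes F: "Defs.linear_map n F"
  shows "F (0\<^sub>m n n) = 0\<^sub>m n n"
proof -
  have "F (0 \<cdot>\<^sub>m 0\<^sub>m n n) = 0 \<cdot>\<^sub>m F (0\<^sub>m n n)"
    by (rule linear_map_smult[OF F zero_carrier_mat])
  also have "\<dots> = 0\<^sub>m n n"
    using linear_map_carrier[OF F zero_carrier_mat] by auto
  finally show ?thesis by simp
qed

lemma linear_map_mat_lincomb:
  assumes F: "Defs.linear_map n F" and "finite S" and "\<And>s. s \<in> S \<Longrightarrow> Y s \<in> carrier_mat n n"
  shows "F (mat_lincomb n S c Y) = mat_lincomb n S c (\<lambda>s. F (Y s))"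
  using assms(2,3)
proof (induction S rule: finite_induct)
  case empty
  show ?case by (simp add: mat_lincomb_empty linear_map_zero[OF F])
next
  case (insert t S)
  then show ?case
    by (simp add: mat_lincomb_insert linear_map_add[OF F] linear_map_smult[OF F]
        linear_map_carrier[OF F])
qed

lemma mat_eq_lincomb_unit_mat:
  assumes "X \<in> carrier_mat n n"
  shows "X = mat_lincomb n ({..<n} \<times> {..<n}) (\<lambda>s. X $$ s) (\<lambda>(k,l). unit_mat n k l)" (is "_ = ?L")
proof (rule eq_matI)
  fix i j assume "i < dim_row ?L" "j < dim_col ?L"
  then have ij: "i < n" "j < n" by (auto simp: mat_lincomb_def)
  have "(\<Sum>s\<in>{..<n} \<times> {..<n}. X $$ s * (case s of (k,l) \<Rightarrow> unit_mat n k l) $$ (i,j))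
      = (\<Sum>s\<in>{..<n} \<times> {..<n}. if s = (i,j) then X $$ s else 0)"
    using ij by (intro sum.cong) (auto simp: unit_mat_def split: if_splits)
  then show "X $$ (i,j) = ?L $$ (i,j)"
    using ij by (simp add: mat_lincomb_def)
qed (use assms in \<open>auto simp: mat_lincomb_def\<close>)

lemma linear_map_cond_op:
  assumes F: "Defs.linear_map m F" and A: "A \<in> carrier_mat d d"
    and X: "X \<in> carrier_mat (d * m) (d * m)" and pq: "p < m" "q < m"
  shows "F (cond_op d m A X) $$ (p,q) = (\<Sum>i<d. \<Sum>j<d. A $$ (i,j) * F (block m X j i) $$ (p,q))"
proof -
  have "F (cond_op d m A X)
      = mat_lincomb m ({..<d} \<times> {..<d}) (\<lambda>(i,j). A $$ (i,j))
          (\<lambda>s. F (case s of (i,j) \<Rightarrow> block m X j i))"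
    unfolding cond_op_eq_mat_lincomb[OF A X] by (rule linear_map_mat_lincomb[OF F]) auto
  then show ?thesis
    using pq by (simp add: mat_lincomb_def sum.cartesian_product split_def)
qed

lemma unit_mat_carrier [simp]: "unit_mat n i j \<in> carrier_mat n n"
  by (simp add: unit_mat_def)

lemma mtrace_mult_unit_mat:
  assumes A: "A \<in> carrier_mat n n" and ij: "i < n" "j < n"
  shows "mtrace (A * unit_mat n i j) = A $$ (j,i)"
proof -
  have "mtrace (A * unit_mat n i j)
      = (\<Sum>r<n. \<Sum>s<n. if s = i then if r = j then A $$ (j,i) else 0 else 0)"
    unfolding mtrace_mult[OF A unit_mat_carrier]
    by (intro sum.cong refl) (auto simp: unit_mat_def)
  then show ?thesis using ij by simp
qed

lemma tensor_map_index:
  assumes G: "Defs.linear_map m G" and pq: "p < d * m" "q < d * m"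
  shows "tensor_map d m F G X $$ (p,q) = (\<Sum>i<d. \<Sum>j<d.
    F (unit_mat d i j) $$ (p div m, q div m) * G (block m X i j) $$ (p mod m, q mod m))"
proof -
  note div_mod = div_mod_less_mult[OF pq(1)] div_mod_less_mult[OF pq(2)]
  have "G (block m X i j) $$ (p mod m, q mod m)
      = (\<Sum>k<m. \<Sum>l<m. X $$ (i * m + k, j * m + l) * G (unit_mat m k l) $$ (p mod m, q mod m))"
    for i j
  proof -
    have "G (block m X i j)
        = mat_lincomb m ({..<m} \<times> {..<m}) (\<lambda>s. block m X i j $$ s)
            (\<lambda>s. G (case s of (k,l) \<Rightarrow> unit_mat m k l))"
      by (subst mat_eq_lincomb_unit_mat[OF block_carrier])
        (rule linear_map_mat_lincomb[OF G], auto)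
    then show ?thesis
      using div_mod by (auto simp: mat_lincomb_def sum.cartesian_product intro!: sum.cong)
  qed
  then show ?thesis
    using pq by (simp add: tensor_map_def sum_distrib_left mult_ac)
qed

lemma tensor_map_id_one:
  assumes F: "Defs.linear_map n F" and A: "A \<in> carrier_mat n n"
  shows "tensor_map 1 n (\<lambda>A. A) F A = F A"
proof (rule eq_matI)
  have "block n A 0 0 = A" using A by (auto simp: block_def)
  then show "tensor_map 1 n (\<lambda>A. A) F A $$ (p,q) = F A $$ (p,q)"
    if "p < dim_row (F A)" "q < dim_col (F A)" for p q
    using that linear_map_carrier[OF F A] by (simp add: tensor_map_index[OF F] unit_mat_def)
qed (use linear_map_carrier[OF F A] in \<open>auto simp: tensor_map_def\<close>)

lemma density_channel:
  assumes F: "channel n F" and A: "density n A"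
  shows "density n (F A)"
proof -
  have linear: "Defs.linear_map n F" and positive: "completely_positive n F"
    and trace: "trace_preserving n F"
    using F by (auto simp: channel_def)
  have psd: "psd n A" and carrier: "A \<in> carrier_mat n n"
    using A by (auto simp: density_def psd_carrier)
  have "psd n (F A)"
    using positive psd tensor_map_id_one[OF linear carrier]
    unfolding completely_positive_def by (metis mult_1)
  then show ?thesis
    using trace carrier A by (simp add: density_def trace_preserving_def)
qed

lemma vn_entropy_channel_smult:
  assumes F: "channel n F" and A: "density n A" and c: "0 \<le> c"
  shows "vn_entropy (F (of_real c \<cdot>\<^sub>m A)) = c * vn_entropy (F A) + eta c"
proof -
  have "F (of_real c \<cdot>\<^sub>m A) = of_real c \<cdot>\<^sub>m F A"
    using F A by (intro linear_map_smult) (auto simp: channel_def density_def psd_carrier)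
  then show ?thesis
    using density_channel[OF F A] vn_entropy_smult[OF _ c, of n "F A"] by (simp add: density_def)
qed

section \<open>The convex roof of the output entropy\<close>

definition decomposition ::
    "nat \<Rightarrow> complex mat \<Rightarrow> 'i set \<Rightarrow> ('i \<Rightarrow> real) \<Rightarrow> ('i \<Rightarrow> complex mat) \<Rightarrow> bool" where
  "decomposition n \<sigma> I p s \<longleftrightarrow> finite I \<and> (\<forall>i\<in>I. 0 \<le> p i \<and> density n (s i)) \<and> sum p I = 1 \<and>
     (\<forall>a<n. \<forall>b<n. \<sigma> $$ (a,b) = (\<Sum>i\<in>I. of_real (p i) * s i $$ (a,b)))"

lemma H_map_eq_Inf:
  "H_map n F \<sigma>
    = Inf {(\<Sum>j<N. p j * vn_entropy (F (s j))) | N p s. decomposition n \<sigma> {..<N :: nat} p s}"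
proof -
  have "decomposition n \<sigma> {..<N} p s \<longleftrightarrow> (\<forall>j<N. 0 \<le> p j \<and> density n (s j)) \<and> (\<Sum>j<N. p j) = 1 \<and>
      (\<forall>a<n. \<forall>b<n. \<sigma> $$ (a,b) = (\<Sum>j<N. of_real (p j) * s j $$ (a,b)))" for N :: nat and p s
    by (auto simp: decomposition_def)
  then show ?thesis by (simp only: H_map_def)
qed

lemma decomposition_singleton: "density n \<sigma> \<Longrightarrow> decomposition n \<sigma> {i} (\<lambda>_. 1) (\<lambda>_. \<sigma>)"
  by (simp add: decomposition_def)

lemma decomposition_reindex:
  assumes "bij_betw h J I" "decomposition n \<sigma> I p s"
  shows "decomposition n \<sigma> J (\<lambda>j. p (h j)) (\<lambda>j. s (h j))"
proof -
  have "(\<Sum>j\<in>J. p (h j)) = sum p I"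
    by (rule sum.reindex_bij_betw[OF assms(1)])
  moreover have "(\<Sum>j\<in>J. of_real (p (h j)) * s (h j) $$ ab) = (\<Sum>i\<in>I. of_real (p i) * s i $$ ab)"
    for ab
    by (rule sum.reindex_bij_betw[OF assms(1)])
  ultimately show ?thesis
    using assms(2) bij_betw_finite[OF assms(1)] bij_betwE[OF assms(1)]
    by (simp add: decomposition_def)
qed

lemma H_map_le:
  assumes dec: "decomposition n \<sigma> I p s"
    and nonneg: "\<And>s. density n s \<Longrightarrow> 0 \<le> vn_entropy (F s)"
  shows "H_map n F \<sigma> \<le> (\<Sum>i\<in>I. p i * vn_entropy (F (s i)))"
proof -
  let ?S = "{(\<Sum>j<N. p j * vn_entropy (F (s j))) | N p s. decomposition n \<sigma> {..<N :: nat} p s}"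
  obtain h where h: "bij_betw h {..<card I} I"
    using dec ex_bij_betw_nat_finite[of I] by (auto simp: decomposition_def lessThan_atLeast0)
  have "bdd_below ?S"
    by (rule bdd_belowI[of _ 0]) (auto simp: decomposition_def nonneg intro!: sum_nonneg)
  moreover have "(\<Sum>j<card I. p (h j) * vn_entropy (F (s (h j)))) \<in> ?S"
    using decomposition_reindex[OF h dec] by (intro CollectI exI) (rule conjI[OF refl])
  ultimately have "H_map n F \<sigma> \<le> (\<Sum>j<card I. p (h j) * vn_entropy (F (s (h j))))"
    unfolding H_map_eq_Inf by (intro cInf_lower)
  also have "\<dots> = (\<Sum>i\<in>I. p i * vn_entropy (F (s i)))"
    by (rule sum.reindex_bij_betw[OF h])
  finally show ?thesis .
qed

lemma H_map_ge:
  assumes \<sigma>: "density n \<sigma>"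
    and bound: "\<And>(N :: nat) p s. decomposition n \<sigma> {..<N} p s
      \<Longrightarrow> c \<le> (\<Sum>j<N. p j * vn_entropy (F (s j)))"
  shows "c \<le> H_map n F \<sigma>"
  unfolding H_map_eq_Inf
proof (rule cInf_greatest)
  have "decomposition n \<sigma> {..<1 :: nat} (\<lambda>_. 1) (\<lambda>_. \<sigma>)"
    using decomposition_singleton[OF \<sigma>, of "0 :: nat"] by (simp add: lessThan_Suc)
  then show "{(\<Sum>j<N. p j * vn_entropy (F (s j))) | N p s. decomposition n \<sigma> {..<N :: nat} p s} \<noteq> {}"
    by blast
qed (use bound in blast)

lemma H_map_approx:
  assumes "density n \<sigma>" "0 < \<epsilon>"
  obtains N :: nat and p s where "decomposition n \<sigma> {..<N} p s"
    "(\<Sum>j<N. p j * vn_entropy (F (s j))) \<le> H_map n F \<sigma> + \<epsilon>"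
proof -
  have "\<not> H_map n F \<sigma> + \<epsilon> \<le> H_map n F \<sigma>" using assms(2) by simp
  then have "\<exists>N p s. decomposition n \<sigma> {..<N :: nat} p s
      \<and> \<not> H_map n F \<sigma> + \<epsilon> \<le> (\<Sum>j<N. p j * vn_entropy (F (s j)))"
    using H_map_ge[OF assms(1)] by blast
  then show thesis using that by (meson linear)
qed

lemma decomposition_Sigma:
  assumes dec: "decomposition n \<sigma> I p \<tau>"
    and refine: "\<And>i. i \<in> I \<Longrightarrow> decomposition n (\<tau> i) (J i) (q i) (s i)"
  shows "decomposition n \<sigma> (Sigma I J) (\<lambda>(i,j). p i * q i j) (\<lambda>(i,j). s i j)"
proof -
  have fin: "finite I" "\<forall>i\<in>I. finite (J i)" and p: "sum p I = 1"
    using dec refine by (auto simp: decomposition_def)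
  have "(\<Sum>(i,j)\<in>Sigma I J. p i * q i j) = (\<Sum>i\<in>I. p i * sum (q i) (J i))"
    by (simp add: sum.Sigma[OF fin, symmetric] sum_distrib_left)
  then have total: "(\<Sum>(i,j)\<in>Sigma I J. p i * q i j) = 1"
    using refine p by (simp add: decomposition_def)
  have average: "\<sigma> $$ (a,b) = (\<Sum>(i,j)\<in>Sigma I J. of_real (p i * q i j) * s i j $$ (a,b))"
    if "a < n" "b < n" for a b
  proof -
    have "(\<Sum>(i,j)\<in>Sigma I J. of_real (p i * q i j) * s i j $$ (a,b))
        = (\<Sum>i\<in>I. of_real (p i) * (\<Sum>j\<in>J i. of_real (q i j) * s i j $$ (a,b)))"
      by (simp add: sum.Sigma[OF fin, symmetric] sum_distrib_left mult.assoc)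
    also have "\<dots> = (\<Sum>i\<in>I. of_real (p i) * \<tau> i $$ (a,b))"
      using refine that by (simp add: decomposition_def)
    finally show ?thesis using dec that by (simp add: decomposition_def)
  qed
  show ?thesis
    using dec refine fin total average by (auto simp: decomposition_def split_def)
qed

lemma H_map_convex:
  assumes dec: "decomposition n \<sigma> I p \<tau>"
    and nonneg: "\<And>s. density n s \<Longrightarrow> 0 \<le> vn_entropy (F s)"
  shows "H_map n F \<sigma> \<le> (\<Sum>i\<in>I. p i * H_map n F (\<tau> i))"
proof (rule field_le_epsilon)
  fix \<epsilon> :: real assume \<epsilon>: "0 < \<epsilon>"
  have finite: "finite I" and weights: "\<And>i. i \<in> I \<Longrightarrow> 0 \<le> p i" "sum p I = 1"
    and states: "\<And>i. i \<in> I \<Longrightarrow> density n (\<tau> i)"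
    using dec by (auto simp: decomposition_def)
  have "\<exists>N q s. decomposition n (\<tau> i) {..<N :: nat} q s
      \<and> (\<Sum>j<N. q j * vn_entropy (F (s j))) \<le> H_map n F (\<tau> i) + \<epsilon>" if "i \<in> I" for i
    using H_map_approx[OF states[OF that] \<epsilon>] by metis
  then obtain N q s where refine: "\<And>i. i \<in> I \<Longrightarrow> decomposition n (\<tau> i) {..<N i :: nat} (q i) (s i)"
    and near: "\<And>i. i \<in> I \<Longrightarrow> (\<Sum>j<N i. q i j * vn_entropy (F (s i j))) \<le> H_map n F (\<tau> i) + \<epsilon>"
    by metis
  have "H_map n F \<sigma> \<le> (\<Sum>(i,j)\<in>(SIGMA i:I. {..<N i}). p i * q i j * vn_entropy (F (s i j)))"
    using H_map_le[OF decomposition_Sigma[OF dec refine], of F] nonneg by (simp add: split_def)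
  also have "\<dots> = (\<Sum>i\<in>I. p i * (\<Sum>j<N i. q i j * vn_entropy (F (s i j))))"
    using finite by (simp add: sum.Sigma[symmetric] sum_distrib_left mult.assoc)
  also have "\<dots> \<le> (\<Sum>i\<in>I. p i * (H_map n F (\<tau> i) + \<epsilon>))"
    by (intro sum_mono mult_left_mono near weights(1))
  also have "\<dots> = (\<Sum>i\<in>I. p i * H_map n F (\<tau> i)) + \<epsilon>"
    using weights(2) by (simp add: distrib_left sum.distrib flip: sum_distrib_right)
  finally show "H_map n F \<sigma> \<le> (\<Sum>i\<in>I. p i * H_map n F (\<tau> i)) + \<epsilon>" .
qed

lemma decomposition_ptrace1:
  assumes dec: "decomposition (d * m) \<rho> I p \<sigma>"
  shows "decomposition m (ptrace1 d m \<rho>) I p (\<lambda>i. ptrace1 d m (\<sigma> i))"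
  using dec density_ptrace1
  by (simp add: decomposition_def ptrace1_def mult_add_less_mult sum_distrib_left sum.swap[of _ I])

lemma decomposition_ptrace2:
  assumes dec: "decomposition (d * m) \<rho> I p \<sigma>"
  shows "decomposition d (ptrace2 d m \<rho>) I p (\<lambda>i. ptrace2 d m (\<sigma> i))"
  using dec density_ptrace2
  by (simp add: decomposition_def ptrace2_def mult_add_less_mult sum_distrib_left sum.swap[of _ I])

lemma psd_eq_smult_density:
  assumes T: "psd n T" and \<tau>: "density n \<tau>"
  obtains s where "density n s" "T = of_real (Re (mtrace T)) \<cdot>\<^sub>m s"
proof (cases "mtrace T = 0")
  case True
  have "T = of_real (Re (mtrace T)) \<cdot>\<^sub>m \<tau>"
    using psd_mtrace_eq_0[OF T True] True \<tau> by (auto simp: density_def psd_def)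
  with \<tau> show thesis by (rule that)
next
  case False
  define q where "q = Re (mtrace T)"
  let ?s = "of_real (1 / q) \<cdot>\<^sub>m T"
  have q: "mtrace T = of_real q" "0 < q"
    using mtrace_nonneg[OF T] False by (auto simp: q_def less_eq_complex_def complex_eq_iff)
  have "psd n ?s"
    using q(2) by (intro psd_smult T) (simp add: less_eq_complex_def)
  moreover have "mtrace ?s = 1"
    using q by (simp add: mtrace_smult[OF psd_carrier[OF T]])
  ultimately have "density n ?s" by (simp add: density_def)
  moreover have "T = of_real (Re (mtrace T)) \<cdot>\<^sub>m ?s"
    using q psd_carrier[OF T] by (intro eq_matI) auto
  ultimately show thesis by (rule that)
qed

lemma decomposition_of_psd_sum:
  assumes \<sigma>: "density n \<sigma>" and "finite I" and T: "\<And>i. i \<in> I \<Longrightarrow> psd n (T i)"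
    and sum: "\<sigma> = mat_lincomb n I (\<lambda>_. 1) T"
  obtains s where "decomposition n \<sigma> I (\<lambda>i. Re (mtrace (T i))) s"
    "\<And>i. i \<in> I \<Longrightarrow> T i = of_real (Re (mtrace (T i))) \<cdot>\<^sub>m s i"
proof -
  have "\<exists>s. density n s \<and> T i = of_real (Re (mtrace (T i))) \<cdot>\<^sub>m s" if "i \<in> I" for i
    using psd_eq_smult_density[OF T[OF that] \<sigma>] by metis
  then obtain s where s: "\<And>i. i \<in> I \<Longrightarrow> density n (s i)"
    and T_eq: "\<And>i. i \<in> I \<Longrightarrow> T i = of_real (Re (mtrace (T i))) \<cdot>\<^sub>m s i" by metis
  have "\<sigma> $$ (a,b) = (\<Sum>i\<in>I. of_real (Re (mtrace (T i))) * s i $$ (a,b))"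
    if "a < n" "b < n" for a b
  proof -
    have "T i $$ (a,b) = of_real (Re (mtrace (T i))) * s i $$ (a,b)" if "i \<in> I" for i
      using arg_cong[OF T_eq[OF that], of "\<lambda>A. A $$ (a,b)"] s[OF that] \<open>a < n\<close> \<open>b < n\<close>
      by (auto simp: density_def psd_def)
    then show ?thesis using that by (simp add: sum mat_lincomb_def)
  qed
  moreover have "(\<Sum>i\<in>I. mtrace (T i)) = 1"
    using \<sigma> mtrace_mat_lincomb[of I T n "\<lambda>_. 1"] psd_carrier[OF T] by (simp add: density_def sum)
  then have "(\<Sum>i\<in>I. Re (mtrace (T i))) = 1"
    by (simp flip: Re_sum)
  ultimately have "decomposition n \<sigma> I (\<lambda>i. Re (mtrace (T i))) s"
    using \<open>finite I\<close> s mtrace_nonneg[OF T] by (auto simp: decomposition_def less_eq_complex_def)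
  then show thesis using T_eq by (rule that)
qed

section \<open>Quantum-classical channels\<close>

definition povm :: "nat \<Rightarrow> nat \<Rightarrow> (nat \<Rightarrow> complex mat) \<Rightarrow> bool" where
  "povm n k M \<longleftrightarrow> (\<forall>j<k. psd n (M j)) \<and> mat_lincomb n {..<k} (\<lambda>_. 1) M = 1\<^sub>m n"

lemma povm_carrier: "povm n k M \<Longrightarrow> j < k \<Longrightarrow> M j \<in> carrier_mat n n"
  by (simp add: povm_def psd_carrier)

lemma sum_povm_index:
  assumes "povm n k M"
  shows "(\<Sum>a<k. \<Sum>i<n. \<Sum>j<n. M a $$ (i,j) * f i j) = (\<Sum>i<n. f i i)"
proof -
  have entry: "(\<Sum>a<k. M a $$ (i,j)) = (if i = j then 1 else 0)" if "i < n" "j < n" for i j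
  proof -
    have "mat_lincomb n {..<k} (\<lambda>_. 1) M $$ (i,j) = 1\<^sub>m n $$ (i,j)"
      using assms by (simp add: povm_def)
    then show ?thesis using that by (simp add: mat_lincomb_def)
  qed
  have "(\<Sum>a<k. \<Sum>i<n. \<Sum>j<n. M a $$ (i,j) * f i j) = (\<Sum>i<n. \<Sum>j<n. (\<Sum>a<k. M a $$ (i,j)) * f i j)"
    by (simp add: sum_distrib_right sum.swap[of _ "{..<k}"])
  also have "\<dots> = (\<Sum>i<n. \<Sum>j<n. if i = j then f i i else 0)"
    by (intro sum.cong refl) (simp add: entry)
  finally show ?thesis by simp
qed

lemma mat_lincomb_cond_op_povm:
  assumes M: "povm d k M" and X: "X \<in> carrier_mat (d * m) (d * m)"
  shows "mat_lincomb m {..<k} (\<lambda>_. 1) (\<lambda>a. cond_op d m (M a) X) = ptrace1 d m X"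
  by (rule eq_matI)
    (simp_all add: mat_lincomb_def ptrace1_def cond_op_index[OF povm_carrier[OF M] X]
      sum_povm_index[OF M])

lemma sum_mtrace_povm_mult:
  assumes M: "povm n k M" and X: "X \<in> carrier_mat n n"
  shows "(\<Sum>a<k. mtrace (M a * X)) = mtrace X"
proof -
  have "(\<Sum>a<k. mtrace (M a * X)) = (\<Sum>i<n. X $$ (i,i))"
    by (simp add: mtrace_mult[OF povm_carrier[OF M] X] sum_povm_index[OF M])
  then show ?thesis using X by (simp add: mtrace_def)
qed

lemma qc_channel_eq_unitary_conj:
  "qc_channel d M e \<sigma>
    = basis_mat d e * mat_diag d (\<lambda>j. mtrace (M j * \<sigma>)) * adj (basis_mat d e)"
  unfolding mat_diag_mult_right[OF basis_mat_carrier]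
  by (rule eq_matI)
    (auto simp: qc_channel_def basis_mat_def adj_def scalar_prod_def lessThan_atLeast0 mult_ac
      intro!: sum.cong)

lemma vn_entropy_qc_channel:
  assumes "orthonormal d e"
  shows "vn_entropy (qc_channel d M e \<sigma>) = (\<Sum>j<d. eta (Re (mtrace (M j * \<sigma>))))"
  unfolding qc_channel_eq_unitary_conj
    vn_entropy_unitary_conj[OF unitary_basis_mat[OF assms] mat_diag_dim] vn_entropy_mat_diag ..

lemma vn_entropy_qc_channel_nonneg:
  assumes M: "povm d d M" and e: "orthonormal d e" and \<sigma>: "density d \<sigma>"
  shows "0 \<le> vn_entropy (qc_channel d M e \<sigma>)"
proof -
  let ?q = "\<lambda>j. Re (mtrace (M j * \<sigma>))"
  have psd: "psd d \<sigma>" and trace_one: "mtrace \<sigma> = 1" using \<sigma> by (auto simp: density_def)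
  have nonneg: "0 \<le> ?q j" if "j < d" for j
    using M that mtrace_mult_psd_nonneg[OF _ psd] by (auto simp: povm_def less_eq_complex_def)
  have "(\<Sum>j<d. ?q j) = 1"
    using sum_mtrace_povm_mult[OF M psd_carrier[OF psd]] trace_one by (simp flip: Re_sum)
  then have "?q j \<le> 1" if "j < d" for j
    using member_le_sum[of j "{..<d}" ?q] nonneg that by auto
  then show ?thesis
    unfolding vn_entropy_qc_channel[OF e] using nonneg by (auto intro!: sum_nonneg eta_nonneg)
qed

lemma tensor_map_qc_channel:
  assumes M: "\<forall>c<d. M c \<in> carrier_mat d d" and \<Omega>: "Defs.linear_map m \<Omega>"
    and X: "X \<in> carrier_mat (d * m) (d * m)"
  shows "tensor_map d m (qc_channel d M e) \<Omega> X
    = kron (basis_mat d e) (1\<^sub>m m) * block_diag d m (\<lambda>c. \<Omega> (cond_op d m (M c) X))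
      * adj (kron (basis_mat d e) (1\<^sub>m m))" (is "?L = ?R")
proof (rule eq_matI)
  have "kron (basis_mat d e) (1\<^sub>m m) \<in> carrier_mat (d * m) (d * m)"
    by (rule kron_carrier) auto
  then have R: "?R \<in> carrier_mat (d * m) (d * m)"
    using adj_carrier by (intro mult_carrier_mat[of _ _ "d * m"]) auto
  then show "dim_row ?L = dim_row ?R" "dim_col ?L = dim_col ?R"
    by (auto simp: tensor_map_def)
  fix p q assume "p < dim_row ?R" "q < dim_col ?R"
  then have pq: "p < d * m" "q < d * m" using R by auto
  note div_mod = div_mod_less_mult[OF pq(1)] div_mod_less_mult[OF pq(2)]
  let ?E = "\<lambda>c. e c $ (p div m) * cnj (e c $ (q div m))"
  let ?Y = "\<lambda>i j. \<Omega> (block m X i j) $$ (p mod m, q mod m)"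
  have "?L $$ (p,q) = (\<Sum>i<d. \<Sum>j<d. \<Sum>c<d. ?E c * (M c $$ (j,i) * ?Y i j))"
    using div_mod
    by (simp add: tensor_map_index[OF \<Omega> pq] qc_channel_def mtrace_mult_unit_mat[OF M[rule_format]]
        sum_distrib_left sum_distrib_right mult_ac)
  also have "\<dots> = (\<Sum>j<d. \<Sum>c<d. \<Sum>i<d. ?E c * (M c $$ (j,i) * ?Y i j))"
    by (subst sum.swap) (intro sum.cong refl sum.swap)
  also have "\<dots> = (\<Sum>c<d. ?E c * (\<Sum>j<d. \<Sum>i<d. M c $$ (j,i) * ?Y i j))"
    by (subst sum.swap) (simp add: sum_distrib_left)
  also have "\<dots> = (\<Sum>c<d. ?E c * \<Omega> (cond_op d m (M c) X) $$ (p mod m, q mod m))"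
    by (intro sum.cong refl) (simp add: linear_map_cond_op[OF \<Omega> M[rule_format] X div_mod(2,4)])
  also have "\<dots> = ?R $$ (p,q)"
    using div_mod by (simp only: kron_one_conj_block_diag_index[OF basis_mat_carrier pq])
      (simp add: basis_mat_def)
  finally show "?L $$ (p,q) = ?R $$ (p,q)" .
qed

lemma vn_entropy_tensor_map_qc_channel:
  assumes M: "\<forall>c<d. M c \<in> carrier_mat d d" and e: "orthonormal d e"
    and \<Omega>: "Defs.linear_map m \<Omega>" and X: "X \<in> carrier_mat (d * m) (d * m)"
  shows "vn_entropy (tensor_map d m (qc_channel d M e) \<Omega> X)
    = (\<Sum>a<d. vn_entropy (\<Omega> (cond_op d m (M a) X)))"
  unfolding tensor_map_qc_channel[OF M \<Omega> X]
    vn_entropy_unitary_conj[OF unitary_kron_one[OF unitary_basis_mat[OF e]] block_diag_carrier]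
  by (rule vn_entropy_block_diag) (simp add: linear_map_carrier[OF \<Omega>])

lemma vn_entropy_tensor_map_qc_channel_ge:
  assumes M: "povm d d M" and e: "orthonormal d e"
    and \<Omega>: "channel m \<Omega>" and \<sigma>: "density (d * m) \<sigma>"
  shows "vn_entropy (qc_channel d M e (ptrace2 d m \<sigma>)) + H_map m \<Omega> (ptrace1 d m \<sigma>)
    \<le> vn_entropy (tensor_map d m (qc_channel d M e) \<Omega> \<sigma>)"
proof -
  let ?T = "\<lambda>a. cond_op d m (M a) \<sigma>"
  define q where "q a = Re (mtrace (?T a))" for a
  have linear: "Defs.linear_map m \<Omega>" using \<Omega> by (simp add: channel_def)
  have psd: "psd (d * m) \<sigma>" using \<sigma> by (simp add: density_def)
  note carrier = psd_carrier[OF psd]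
  have M_carrier: "\<forall>c<d. M c \<in> carrier_mat d d" using povm_carrier[OF M] by blast
  have T: "psd m (?T a)" if "a < d" for a
    using M that psd_cond_op[OF _ psd] by (simp add: povm_def)
  obtain s where dec: "decomposition m (ptrace1 d m \<sigma>) {..<d} q s"
    and T_eq: "\<And>a. a < d \<Longrightarrow> ?T a = of_real (q a) \<cdot>\<^sub>m s a"
    using decomposition_of_psd_sum[OF density_ptrace1[OF \<sigma>] finite_lessThan _
        mat_lincomb_cond_op_povm[OF M carrier, symmetric]] T unfolding q_def by (metis lessThan_iff)
  have "vn_entropy (\<Omega> (?T a)) = q a * vn_entropy (\<Omega> (s a)) + eta (q a)" if "a < d" for a
    using dec that T_eq[OF that] vn_entropy_channel_smult[OF \<Omega>] by (simp add: decomposition_def)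
  then have "vn_entropy (tensor_map d m (qc_channel d M e) \<Omega> \<sigma>)
      = (\<Sum>a<d. q a * vn_entropy (\<Omega> (s a))) + (\<Sum>a<d. eta (q a))"
    by (simp add: vn_entropy_tensor_map_qc_channel[OF M_carrier e linear carrier] sum.distrib)
  moreover have "(\<Sum>a<d. eta (q a)) = vn_entropy (qc_channel d M e (ptrace2 d m \<sigma>))"
    unfolding vn_entropy_qc_channel[OF e] q_def
    by (simp add: mtrace_cond_op[OF povm_carrier[OF M] carrier])
  moreover have "H_map m \<Omega> (ptrace1 d m \<sigma>) \<le> (\<Sum>a<d. q a * vn_entropy (\<Omega> (s a)))"
    using H_map_le[OF dec] vn_entropy_density_nonneg[OF density_channel[OF \<Omega>]] by blast
  ultimately show ?thesis by simp
qed

theorem theorem5: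
  fixes d m :: nat and M :: "nat \<Rightarrow> complex mat" and e :: "nat \<Rightarrow> complex vec"
    and \<Omega> :: "complex mat \<Rightarrow> complex mat" and \<rho> :: "complex mat"
  assumes M_pd: "\<forall>j<d. pd d (M j)"
    and M_sum: "\<forall>a<d. \<forall>b<d. (\<Sum>j<d. M j $$ (a,b)) = (1\<^sub>m d) $$ (a,b)"
    and e_carrier: "\<forall>j<d. e j \<in> carrier_vec d"
    and e_orthonormal: "\<forall>i<d. \<forall>j<d. cinner (e i) (e j) = (if i = j then 1 else 0)"
    and \<Omega>_channel: "channel m \<Omega>"
    and \<rho>_state: "density (d*m) \<rho>"
  shows "H_map (d*m) (tensor_map d m (qc_channel d M e) \<Omega>) \<rho>
     \<ge> H_map d (qc_channel d M e) (ptrace2 d m \<rho>) + H_map m \<Omega> (ptrace1 d m \<rho>)"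
proof (rule H_map_ge[OF \<rho>_state])
  let ?\<Phi> = "qc_channel d M e"
  have M: "povm d d M"
    using M_pd M_sum pd_imp_psd by (auto simp: povm_def mat_lincomb_def)
  have e: "orthonormal d e"
    using e_carrier e_orthonormal by (simp add: orthonormal_def)
  fix N p \<sigma> assume dec: "decomposition (d * m) \<rho> {..<N :: nat} p \<sigma>"
  then have \<sigma>: "0 \<le> p i" "density (d * m) (\<sigma> i)" if "i < N" for i
    using that by (auto simp: decomposition_def)
  have "H_map d ?\<Phi> (ptrace2 d m \<rho>) \<le> (\<Sum>i<N. p i * vn_entropy (?\<Phi> (ptrace2 d m (\<sigma> i))))"
    using decomposition_ptrace2[OF dec] vn_entropy_qc_channel_nonneg[OF M e] by (rule H_map_le)
  moreover have "H_map m \<Omega> (ptrace1 d m \<rho>) \<le> (\<Sum>i<N. p i * H_map m \<Omega> (ptrace1 d m (\<sigma> i)))"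
    using decomposition_ptrace1[OF dec] vn_entropy_density_nonneg[OF density_channel[OF \<Omega>_channel]]
    by (rule H_map_convex)
  ultimately have "H_map d ?\<Phi> (ptrace2 d m \<rho>) + H_map m \<Omega> (ptrace1 d m \<rho>)
      \<le> (\<Sum>i<N. p i * (vn_entropy (?\<Phi> (ptrace2 d m (\<sigma> i))) + H_map m \<Omega> (ptrace1 d m (\<sigma> i))))"
    by (simp add: sum.distrib distrib_left)
  also have "\<dots> \<le> (\<Sum>i<N. p i * vn_entropy (tensor_map d m ?\<Phi> \<Omega> (\<sigma> i)))"
    using vn_entropy_tensor_map_qc_channel_ge[OF M e \<Omega>_channel] \<sigma>
    by (intro sum_mono mult_left_mono) auto
  finally show "H_map d ?\<Phi> (ptrace2 d m \<rho>) + H_map m \<Omega> (ptrace1 d m \<rho>)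
      \<le> (\<Sum>i<N. p i * vn_entropy (tensor_map d m ?\<Phi> \<Omega> (\<sigma> i)))" .
qed

end
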